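(* Let $(X,\rho,\mu)$ be a space of homogeneous type satisfying the standing assumptions listed in the context, with finite diameter $d<\infty$. Let $1<p<\infty$, $\theta>0$ and $0\le\lambda<1$. Then the Hardy--Littlewood maximal operator $$(Mf)(x)=\sup_{0<r<d}\frac{1}{\mu(B(x,r))}\int_{B(x,r)}|f(y)|\,d\mu(y),\qquad x\in X,$$ is bounded in the grand Morrey space $L^{p),\theta,\lambda}(X,\mu)$; that is, there is a constant $C>0$ such that $\|Mf\|_{L^{p),\theta,\lambda}(X,\mu)}\le C\|f\|_{L^{p),\theta,\lambda}(X,\mu)}$ for all $f\in L^{p),\theta,\lambda}(X,\mu)$.
   Context: Standing assumptions on $(X,\rho,\mu)$. $X$ is a topological space with a complete measure $\mu$ such that the compactly supported continuous functions are dense in $L^1(X,\mu)$, and $\rho:X\times X\to[0,\infty)$ is a quasi-metric: (i) $\rho(x,y)=0$ iff $x=y$; (ii) there is $a_1>0$ with $\rho(x,y)\le a_1(\rho(x,z)+\rho(z,y))$ for all $x,y,z\in X$; (iii) there is $a_0>0$ with $\rho(x,y)\le a_0\rho(y,x)$ for all $x,y\in X$. Balls $B(x,r)=\{y\in X:\rho(x,y)<r\}$ are measurable with $0<\mu(B(x,r))<\infty$ for all $x\in X$, $r>0$; for every neighborhood $V$ of $x\in X$ there is $r>0$ with $B(x,r)\subset V$; $\mu\{x\}=0$ for all $x\in X$; $d:=\operatorname{diam}(X)=\sup\{\rho(x,y):x,y\in X\}<\infty$; $B(x,R)\setminus B(x,r)\ne\emptyset$ for all $x\in X$ and $0<r<R<d$;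 and $\mu$ is doubling: there is $c>0$ with $\mu(B(x,2r))\le c\,\mu(B(x,r))$ for all $x\in X$, $r>0$. Grand Morrey space. For $1<p<\infty$, $\theta>0$, $0\le\lambda<1$, $L^{p),\theta,\lambda}(X,\mu)$ is the class of measurable $f:X\to\mathbb{R}$ for which $$\|f\|_{L^{p),\theta,\lambda}(X,\mu)}=\sup_{0<\varepsilon<p-1}\ \sup_{x\in X,\ 0<r<d}\left[\frac{\varepsilon^{\theta}}{(\mu(B(x,r)))^{\lambda}}\int_{B(x,r)}|f(y)|^{p-\varepsilon}\,d\mu(y)\right]^{\frac{1}{p-\varepsilon}}<\infty .$$
   Formalization: Under the standing assumptions Mf need not be measurable (balls may depend non-measurably on their centre), so the integrals in the grand Morrey norm of Mf are read as upper integrals; for measurable Mf this is the stated norm and inequality. *)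

theory Defs
  imports "HOL-Analysis.Analysis"
begin

definition qball :: "('a \<Rightarrow> 'a \<Rightarrow> real) \<Rightarrow> 'a \<Rightarrow> real \<Rightarrow> 'a set" where
  "qball \<rho> x r = {y. \<rho> x y < r}"

text \<open>A supremum in the reals, hence meaningful only for bounded \<open>\<rho>\<close>; boundedness is an axiom of
  the locale below.\<close>

definition qdiam :: "('a \<Rightarrow> 'a \<Rightarrow> real) \<Rightarrow> real" where
  "qdiam \<rho> = (SUP (x, y) \<in> UNIV. \<rho> x y)"

definition compactly_supported_continuous :: "('a::topological_space \<Rightarrow> real) set" where
  "compactly_supported_continuous =
    {g. continuous_on UNIV g \<and> compact (closure {x. g x \<noteq> 0})}"

text \<open>The set \<open>X\<close> is the whole type. Density of a set of functions in \<open>L\<^sup>1\<close> includes that its members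
  belong to \<open>L\<^sup>1\<close>.\<close>

locale homogeneous_type_space = complete_measure M
  for M :: "'a::topological_space measure" +
  fixes \<rho> :: "'a \<Rightarrow> 'a \<Rightarrow> real"
  assumes space_UNIV: "space M = UNIV"
    and Cc_integrable: "\<And>g. g \<in> compactly_supported_continuous \<Longrightarrow> integrable M g"
    and Cc_dense: "\<And>f e. integrable M f \<Longrightarrow> 0 < e \<Longrightarrow>
          \<exists>g\<in>compactly_supported_continuous. (\<integral>x. \<bar>f x - g x\<bar> \<partial>M) < e"
    and rho_nonneg: "\<And>x y. 0 \<le> \<rho> x y"
    and rho_eq_0_iff: "\<And>x y. \<rho> x y = 0 \<longleftrightarrow> x = y"
    and quasi_triangle: "\<exists>a1>0. \<forall>x y z. \<rho> x y \<le> a1 * (\<rho> x z + \<rho> z y)"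
    and quasi_symmetric: "\<exists>a0>0. \<forall>x y. \<rho> x y \<le> a0 * \<rho> y x"
    and qball_measurable: "\<And>x r. 0 < r \<Longrightarrow> qball \<rho> x r \<in> sets M"
    and qball_pos: "\<And>x r. 0 < r \<Longrightarrow> 0 < emeasure M (qball \<rho> x r)"
    and qball_finite: "\<And>x r. 0 < r \<Longrightarrow> emeasure M (qball \<rho> x r) < \<infinity>"
    and qball_in_neighbourhood: "\<And>x V. open V \<Longrightarrow> x \<in> V \<Longrightarrow> \<exists>r>0. qball \<rho> x r \<subseteq> V"
    and singleton_null: "\<And>x. {x} \<in> null_sets M"
    and finite_diameter: "bdd_above (range (\<lambda>(x, y). \<rho> x y))"
    and annulus_nonempty:
      "\<And>x r R. 0 < r \<Longrightarrow> r < R \<Longrightarrow> R < qdiam \<rho> \<Longrightarrow> qball \<rho> x R - qball \<rho> x r \<noteq> {}"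
    and doubling: "\<exists>c::real>0. \<forall>x. \<forall>r>0.
      emeasure M (qball \<rho> x (2 * r)) \<le> ennreal c * emeasure M (qball \<rho> x r)"

definition hl_maximal ::
    "'a measure \<Rightarrow> ('a \<Rightarrow> 'a \<Rightarrow> real) \<Rightarrow> ('a \<Rightarrow> real) \<Rightarrow> 'a \<Rightarrow> ennreal" where
  "hl_maximal M \<rho> f x = (SUP r\<in>{0<..<qdiam \<rho>}.
     (\<integral>\<^sup>+y\<in>qball \<rho> x r. ennreal \<bar>f y\<bar> \<partial>M) / emeasure M (qball \<rho> x r))"

definition epowr :: "ennreal \<Rightarrow> real \<Rightarrow> ennreal" where
  "epowr t a = (if t = \<infinity> then \<infinity> else ennreal (enn2real t powr a))"

text \<open>The axioms on \<open>\<rho>\<close> and the measure do not make the maximal function measurable, because a ball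
  may depend on its centre in a non-measurable way. On a function that is not measurable,
  \<open>nn_integral\<close> is a lower integral, which would make an upper bound for the norm of the maximal
  function too weak. The norm is therefore built on the upper integral, which is the ordinary integral
  for measurable functions (\<open>upper_nn_integral_eq\<close>, \<open>grand_morrey_norm_eq\<close>).\<close>

definition upper_nn_integral :: "'a measure \<Rightarrow> ('a \<Rightarrow> ennreal) \<Rightarrow> ennreal" where
  "upper_nn_integral M F =
    (INF G\<in>{G \<in> borel_measurable M. \<forall>x\<in>space M. F x \<le> G x}. \<integral>\<^sup>+x. G x \<partial>M)"

text \<open>The norm takes \<open>[0,\<infinity>]\<close>-valued arguments (the absolute value of a function), since the maximal
  function may be infinite at some points.\<close>

definition grand_morrey_norm ::
    "'a measure \<Rightarrow> ('a \<Rightarrow> 'a \<Rightarrow> real) \<Rightarrow> real \<Rightarrow> real \<Rightarrow> real \<Rightarrow> ('a \<Rightarrow> ennreal) \<Rightarrow> ennreal" where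
  "grand_morrey_norm M \<rho> p \<theta> lam F =
    (SUP \<epsilon>\<in>{0<..<p - 1}. SUP x. SUP r\<in>{0<..<qdiam \<rho>}.
       epowr (ennreal (\<epsilon> powr \<theta> / measure M (qball \<rho> x r) powr lam) *
              upper_nn_integral M (\<lambda>y. epowr (F y) (p - \<epsilon>) * indicator (qball \<rho> x r) y))
         (1 / (p - \<epsilon>)))"

definition grand_morrey_space ::
    "'a measure \<Rightarrow> ('a \<Rightarrow> 'a \<Rightarrow> real) \<Rightarrow> real \<Rightarrow> real \<Rightarrow> real \<Rightarrow> ('a \<Rightarrow> real) set" where
  "grand_morrey_space M \<rho> p \<theta> lam =
    {f \<in> borel_measurable M. grand_morrey_norm M \<rho> p \<theta> lam (\<lambda>x. ennreal \<bar>f x\<bar>) < \<infinity>}"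

lemma upper_nn_integral_eq:
  assumes "F \<in> borel_measurable M"
  shows "upper_nn_integral M F = (\<integral>\<^sup>+x. F x \<partial>M)"
  unfolding upper_nn_integral_def
proof (rule antisym)
  show "(INF G\<in>{G \<in> borel_measurable M. \<forall>x\<in>space M. F x \<le> G x}. \<integral>\<^sup>+x. G x \<partial>M) \<le> (\<integral>\<^sup>+x. F x \<partial>M)"
    using assms by (intro INF_lower) auto
  show "(\<integral>\<^sup>+x. F x \<partial>M) \<le> (INF G\<in>{G \<in> borel_measurable M. \<forall>x\<in>space M. F x \<le> G x}. \<integral>\<^sup>+x. G x \<partial>M)"
    by (intro INF_greatest nn_integral_mono) auto
qed

lemma borel_measurable_epowr [measurable]:
  assumes [measurable]: "F \<in> borel_measurable M"
  shows "(\<lambda>x. epowr (F x) a) \<in> borel_measurable M"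
  unfolding epowr_def by measurable

lemma epowr_ennreal: "0 \<le> t \<Longrightarrow> epowr (ennreal t) a = ennreal (t powr a)"
  by (simp add: epowr_def)

lemma (in homogeneous_type_space) grand_morrey_norm_eq:
  assumes [measurable]: "f \<in> borel_measurable M"
  shows "grand_morrey_norm M \<rho> p \<theta> lam (\<lambda>x. ennreal \<bar>f x\<bar>) =
    (SUP \<epsilon>\<in>{0<..<p - 1}. SUP x. SUP r\<in>{0<..<qdiam \<rho>}.
       epowr (ennreal (\<epsilon> powr \<theta> / measure M (qball \<rho> x r) powr lam) *
              (\<integral>\<^sup>+y\<in>qball \<rho> x r. ennreal (\<bar>f y\<bar> powr (p - \<epsilon>)) \<partial>M))
         (1 / (p - \<epsilon>)))"
proof -
  have "upper_nn_integral M (\<lambda>y. epowr (ennreal \<bar>f y\<bar>) q * indicator (qball \<rho> x r) y) =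
      (\<integral>\<^sup>+y\<in>qball \<rho> x r. ennreal (\<bar>f y\<bar> powr q) \<partial>M)" if "0 < r" for x r q
  proof -
    have [measurable]: "qball \<rho> x r \<in> sets M"
      using that by (rule qball_measurable)
    show ?thesis
      by (subst upper_nn_integral_eq) (auto simp: epowr_ennreal)
  qed
  then show ?thesis
    unfolding grand_morrey_norm_def by (intro SUP_cong refl) auto
qed

end

theory Submission
  imports Defs
begin

text \<open>By the Vitali covering argument and doubling the maximal operator is of weak type (1,1), and
  Marcinkiewicz interpolation bounds it on \<open>L\<^sup>q\<close>, uniformly for \<open>q\<close> in a compact subset of
  \<open>(1, \<infinity>)\<close>. On a ball \<open>B\<close> the averages of \<open>f\<close> over balls smaller than \<open>B\<close> only see the restriction of
  \<open>f\<close> to a dilate of \<open>B\<close>, where the \<open>L\<^sup>q\<close> bound applies, while the averages over larger balls are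
  controlled directly by the Morrey norm through comparison of power means. This gives boundedness in the
  Morrey space with exponent \<open>p - \<epsilon>\<close>, uniformly for \<open>\<epsilon> \<le> (p - 1) / 2\<close>. For the remaining \<open>\<epsilon>\<close>, where the
  constants blow up, power means are compared with the exponent at \<open>\<epsilon> = (p - 1) / 2\<close>, which costs
  only a bounded factor since \<open>\<mu>(X) < \<infinity>\<close>.\<close>

section \<open>Division in \<open>ennreal\<close> and the Vitali selection principle\<close>

lemma divide_le_iff_ennreal:
  fixes a b c :: ennreal
  assumes "0 < b" "b < top"
  shows "a / b \<le> c \<longleftrightarrow> a \<le> c * b"
proof
  assume "a / b \<le> c"
  then have "a / b * b \<le> c * b"
    by (rule mult_right_mono) simp
  then show "a \<le> c * b"
    using assms by (simp add: ennreal_divide_times)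
qed (use assms in \<open>simp add: divide_le_posI_ennreal mult.commute\<close>)

text \<open>Zorn's lemma gives a maximal disjoint subfamily \<open>S\<close> such that every set
  meeting \<open>S\<close> meets a member of at least half its radius. Such an \<open>S\<close>
  meets every set of the family: otherwise, among the sets missing \<open>S\<close>, one of nearly
  largest radius could be added.\<close>

lemma Vitali_selection:
  fixes B :: "'i \<Rightarrow> 'a set" and r :: "'i \<Rightarrow> real"
  assumes pos: "\<And>i. i \<in> I \<Longrightarrow> 0 < r i" and bdd: "bdd_above (r ` I)"
    and ne: "\<And>i. i \<in> I \<Longrightarrow> B i \<noteq> {}"
  obtains S where "S \<subseteq> I" "disjoint_family_on B S"
    "\<And>i. i \<in> I \<Longrightarrow> \<exists>j\<in>S. B i \<inter> B j \<noteq> {} \<and> r i \<le> 2 * r j"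
proof -
  define meets where "meets i S \<longleftrightarrow> (\<exists>j\<in>S. B i \<inter> B j \<noteq> {})" for i S
  \<comment> \<open>The size condition is imposed only on sets meeting \<open>S\<close>, so the
    empty family qualifies and unions of chains inherit it: a set meeting the union already meets
    one link of the chain.\<close>
  define \<A> where "\<A> = {S. S \<subseteq> I \<and> disjoint_family_on B S \<and>
    (\<forall>i\<in>I. meets i S \<longrightarrow> (\<exists>j\<in>S. B i \<inter> B j \<noteq> {} \<and> r i \<le> 2 * r j))}"
  have "\<exists>S\<in>\<A>. \<forall>T\<in>\<A>. S \<subseteq> T \<longrightarrow> T = S"
  proof (rule subset_Zorn')
    fix \<C> assume C: "subset.chain \<A> \<C>"
    then have sub: "\<C> \<subseteq> \<A>"
      by (simp add: subset_chain_def)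
    have "disjoint_family_on B (\<Union>\<C>)"
      unfolding disjoint_family_on_def
    proof (intro ballI impI)
      fix i j assume "i \<in> \<Union>\<C>" "j \<in> \<Union>\<C>" "i \<noteq> j"
      then obtain S T where "S \<in> \<C>" "i \<in> S" "T \<in> \<C>" "j \<in> T" by blast
      moreover have "S \<subseteq> T \<or> T \<subseteq> S"
        using C \<open>S \<in> \<C>\<close> \<open>T \<in> \<C>\<close> by (simp add: subset_chain_def)
      ultimately obtain U where "U \<in> \<C>" "i \<in> U" "j \<in> U" by blast
      then have "disjoint_family_on B U"
        using sub by (auto simp: \<A>_def)
      then show "B i \<inter> B j = {}"
        using \<open>i \<in> U\<close> \<open>j \<in> U\<close> \<open>i \<noteq> j\<close> by (simp add: disjoint_family_on_def)
    qed
    moreover have "\<exists>j\<in>\<Union>\<C>. B i \<inter> B j \<noteq> {} \<and> r i \<le> 2 * r j" if "i \<in> I" "meets i (\<Union>\<C>)" for i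
    proof -
      from that(2) obtain S where "S \<in> \<C>" "meets i S"
        by (auto simp: meets_def)
      then show ?thesis
        using sub \<open>i \<in> I\<close> unfolding \<A>_def by blast
    qed
    ultimately show "\<Union>\<C> \<in> \<A>"
      using sub by (auto simp: \<A>_def)
  qed
  then obtain S where S: "S \<in> \<A>" and max: "\<And>T. T \<in> \<A> \<Longrightarrow> S \<subseteq> T \<Longrightarrow> T = S"
    by blast
  have "meets i S" if "i \<in> I" for i
  proof (rule ccontr)
    define J where "J = {j \<in> I. \<not> meets j S}"
    assume "\<not> meets i S"
    then have "i \<in> J"
      using that by (simp add: J_def)
    have "bdd_above (r ` J)"
      using bdd by (rule bdd_above_mono) (auto simp: J_def)
    then have le: "r j \<le> Sup (r ` J)" if "j \<in> J" for j
      using that by (intro cSup_upper) auto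
    have "0 < Sup (r ` J)"
      using le[OF \<open>i \<in> J\<close>] pos[OF \<open>i \<in> I\<close>] by simp
    \<comment> \<open>The supremum need not be attained, but a radius above half of it exists. A set
      met by the new \<open>B j\<close> and missing \<open>S\<close> has radius at most the
      supremum, hence below \<open>2 * r j\<close>.\<close>
    then have "Sup (r ` J) / 2 < Sup (r ` J)"
      by simp
    then obtain j where j: "j \<in> J" "Sup (r ` J) / 2 < r j"
      using less_cSup_iff[of "r ` J"] \<open>bdd_above (r ` J)\<close> \<open>i \<in> J\<close> by blast
    have "insert j S \<in> \<A>"
    proof -
      have "disjoint_family_on B (insert j S)"
        using S j(1) by (auto simp: \<A>_def J_def meets_def disjoint_family_on_def)
      moreover have "\<exists>l\<in>insert j S. B k \<inter> B l \<noteq> {} \<and> r k \<le> 2 * r l"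
        if k: "k \<in> I" "meets k (insert j S)" for k
      proof (cases "meets k S")
        case True
        then show ?thesis
          using S k(1) unfolding \<A>_def by blast
      next
        case False
        then have "k \<in> J" "B k \<inter> B j \<noteq> {}"
          using k by (auto simp: J_def meets_def)
        then show ?thesis
          using le[of k] j(2) by force
      qed
      ultimately show ?thesis
        using S j(1) by (auto simp: \<A>_def J_def)
    qed
    then have "j \<in> S"
      using max by blast
    then have "meets j S"
      using ne[of j] j(1) by (auto simp: meets_def J_def)
    then show False
      using j(1) by (simp add: J_def)
  qed
  with S show thesis
    by (intro that[of S]) (auto simp: \<A>_def)
qed

subsection \<open>Truncated powers and upper integrals\<close>

lemma epowr_mono: "F \<le> G \<Longrightarrow> 0 \<le> a \<Longrightarrow> epowr F a \<le> epowr G a"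
  by (auto simp: epowr_def top_unique less_top enn2real_mono intro!: ennreal_leI powr_mono2)

lemma epowr_max_le: "0 \<le> a \<Longrightarrow> epowr (max F G) a \<le> epowr F a + epowr G a"
  by (simp add: max_def)

lemma upper_nn_integral_le:
  "G \<in> borel_measurable M \<Longrightarrow> (\<And>x. x \<in> space M \<Longrightarrow> F x \<le> G x) \<Longrightarrow>
     upper_nn_integral M F \<le> (\<integral>\<^sup>+x. G x \<partial>M)"
  unfolding upper_nn_integral_def by (rule INF_lower) simp

text \<open>If \<open>H\<close> is a measurable majorant of \<open>G\<close>, then
  \<open>h + c * H\<close> is one of \<open>F\<close>.\<close>

lemma upper_nn_integral_affine_le:
  assumes [measurable]: "h \<in> borel_measurable M" and "c \<noteq> \<infinity>"
    and le: "\<And>x. x \<in> space M \<Longrightarrow> F x \<le> h x + c * G x"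
  shows "upper_nn_integral M F \<le> (\<integral>\<^sup>+x. h x \<partial>M) + c * upper_nn_integral M G"
proof (cases "c = 0")
  case True
  then show ?thesis
    using le upper_nn_integral_le[of h M F] by simp
next
  case False
  \<comment> \<open>Solved for \<open>x\<close>, the inequality says that a fixed number is a lower
    bound of the integrals of all majorants, and so passes to their infimum.\<close>
  have iff: "a \<le> b + c * x \<longleftrightarrow> (a - b) / c \<le> x" if "b \<noteq> \<infinity>" for a b x :: ennreal
    using False \<open>c \<noteq> \<infinity>\<close> that
    by (subst divide_le_iff_ennreal) (auto simp: ennreal_minus_le_iff less_top mult.commute zero_less_iff_neq_zero)
  have "upper_nn_integral M F \<le> (\<integral>\<^sup>+x. h x \<partial>M) + c * (\<integral>\<^sup>+x. H x \<partial>M)"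
    if [measurable]: "H \<in> borel_measurable M" and H: "\<forall>x\<in>space M. G x \<le> H x" for H
  proof -
    have "upper_nn_integral M F \<le> (\<integral>\<^sup>+x. h x + c * H x \<partial>M)"
      using H by (intro upper_nn_integral_le) (auto intro!: order_trans[OF le] add_left_mono mult_left_mono)
    also have "\<dots> = (\<integral>\<^sup>+x. h x \<partial>M) + c * (\<integral>\<^sup>+x. H x \<partial>M)"
      by (simp add: nn_integral_add nn_integral_cmult)
    finally show ?thesis .
  qed
  note le_H = this
  show ?thesis
  proof (cases "(\<integral>\<^sup>+x. h x \<partial>M) = \<infinity>")
    case False
    show ?thesis
      using le_H unfolding iff[OF False] upper_nn_integral_def[of M G] by (intro INF_greatest) auto
  qed simp
qed

text \<open>A geometric sum over the levels below \<open>u\<close>. The minimum makes the bound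
  inductive: a term is added only when \<open>t * 2 ^ n < u\<close>, where the minimum at
  \<open>n\<close> and at \<open>Suc n\<close> is the level itself, and
  \<open>x / (c - 1) + x = c * x / (c - 1)\<close> with \<open>c = 2 powr a\<close>.\<close>

lemma sum_dyadic_powr_le:
  fixes a t u :: real
  assumes "0 < a" "0 < t" "0 \<le> u"
  shows "(\<Sum>k<n. if t * 2 ^ k < u then (t * 2 ^ k) powr a else 0)
    \<le> min (t * 2 ^ n) (2 * u) powr a / (2 powr a - 1)"
proof (induction n)
  case 0
  show ?case
    using assms by (simp add: ge_one_powr_ge_zero)
next
  case (Suc n)
  have pos: "1 < (2::real) powr a"
    using assms by simp
  show ?case
  proof (cases "t * 2 ^ n < u")
    case True
    have "(\<Sum>k<Suc n. if t * 2 ^ k < u then (t * 2 ^ k) powr a else 0)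
      \<le> (t * 2 ^ n) powr a / (2 powr a - 1) + (t * 2 ^ n) powr a"
      using Suc True assms by (simp add: min_def)
    also have "\<dots> = 2 powr a * (t * 2 ^ n) powr a / (2 powr a - 1)"
      using pos assms by (simp add: divide_simps) (simp add: algebra_simps)
    also have "2 powr a * (t * 2 ^ n) powr a = min (t * 2 ^ Suc n) (2 * u) powr a"
      using True assms by (simp add: min_def powr_mult mult_ac)
    finally show ?thesis .
  next
    case False
    have "min (t * 2 ^ n) (2 * u) powr a \<le> min (t * 2 ^ Suc n) (2 * u) powr a"
      using assms by (intro powr_mono2 min.mono) auto
    then have "min (t * 2 ^ n) (2 * u) powr a / (2 powr a - 1) \<le> min (t * 2 ^ Suc n) (2 * u) powr a / (2 powr a - 1)"
      using pos by (intro divide_right_mono) auto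
    with Suc False show ?thesis
      by simp
  qed
qed

lemma suminf_dyadic_powr_le:
  fixes a t u :: real
  assumes "0 < a" "0 < t" "0 \<le> u"
  shows "(\<Sum>k. ennreal (if t * 2 ^ k < u then (t * 2 ^ k) powr a else 0))
    \<le> ennreal ((2 * u) powr a / (2 powr a - 1))"
proof (rule suminf_le_const)
  fix n
  have "(\<Sum>k<n. if t * 2 ^ k < u then (t * 2 ^ k) powr a else 0)
    \<le> min (t * 2 ^ n) (2 * u) powr a / (2 powr a - 1)"
    by (rule sum_dyadic_powr_le[OF assms])
  also have "\<dots> \<le> (2 * u) powr a / (2 powr a - 1)"
    using assms by (intro divide_right_mono powr_mono2) (auto simp: ge_one_powr_ge_zero)
  finally show "(\<Sum>k<n. ennreal (if t * 2 ^ k < u then (t * 2 ^ k) powr a else 0))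
    \<le> ennreal ((2 * u) powr a / (2 powr a - 1))"
    by (subst sum_ennreal) (auto intro: ennreal_leI)
qed simp

text \<open>A discrete layer-cake bound. A finite value above \<open>t\<close> lies between some
  \<open>t * 2 ^ k\<close> and twice that, so the single term \<open>k\<close> suffices; an infinite
  value exceeds every level and makes the sum diverge. In use, \<open>E k\<close> is a measurable
  superset of a superlevel set.\<close>

lemma epowr_le_dyadic_sum:
  assumes "0 < t" "1 \<le> q" and E: "\<And>k. ennreal (t * 2 ^ k) < F \<Longrightarrow> y \<in> E k"
  shows "epowr F q \<le> ennreal (t powr q) + (\<Sum>k. ennreal ((2 * (t * 2 ^ k)) powr q) * indicator (E k) y)"
    (is "_ \<le> _ + suminf ?s")
proof -
  have term_le: "ennreal ((2 * (t * 2 ^ k)) powr q) \<le> suminf ?s" if "ennreal (t * 2 ^ k) < F" for k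
    using sum_le_suminf[of ?s "{k}"] E[OF that] by simp
  show ?thesis
  proof (cases F rule: ennreal_cases)
    case (real v)
    show ?thesis
    proof (cases "v \<le> t")
      case True
      then have "epowr F q \<le> ennreal (t powr q)"
        using real assms by (auto simp: epowr_ennreal intro!: ennreal_leI powr_mono2)
      then show ?thesis
        by (simp add: add_increasing2)
    next
      case False
      obtain n where "v / t < 2 ^ n"
        using real_arch_pow[of 2 "v / t"] by auto
      then have ex: "v \<le> t * 2 ^ n"
        using \<open>0 < t\<close> by (simp add: field_simps)
      \<comment> \<open>The least \<open>m\<close> is not 0 because \<open>t < v\<close>; its
        predecessor \<open>k\<close> satisfies \<open>t * 2 ^ k < v\<close> and
        \<open>v \<le> 2 * (t * 2 ^ k)\<close>.\<close>
      define m where "m = (LEAST n. v \<le> t * 2 ^ n)"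
      have m: "v \<le> t * 2 ^ m"
        unfolding m_def using ex by (rule LeastI)
      then have "m \<noteq> 0"
        using False by (cases m) auto
      then obtain k where k: "m = Suc k"
        using not0_implies_Suc by blast
      then have "t * 2 ^ k < v"
        using not_less_Least[of k "\<lambda>n. v \<le> t * 2 ^ n"] by (auto simp: m_def)
      then have "ennreal (t * 2 ^ k) < F"
        using real assms by (simp add: ennreal_less_iff)
      from term_le[OF this] have "ennreal ((2 * (t * 2 ^ k)) powr q) \<le> suminf ?s" .
      moreover have "epowr F q \<le> ennreal ((2 * (t * 2 ^ k)) powr q)"
        using real m k assms by (auto simp: epowr_ennreal mult_ac intro!: ennreal_leI powr_mono2)
      ultimately show ?thesis
        by (meson add_increasing order_trans zero_le)
    qed
  next
    case top
    have "suminf ?s = \<infinity>"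
    proof (rule ccontr)
      assume "suminf ?s \<noteq> \<infinity>"
      then obtain s where s: "suminf ?s = ennreal s" "0 \<le> s"
        by (cases "suminf ?s" rule: ennreal_cases) auto
      obtain k where k: "max 1 (s + 1) / t < 2 ^ k"
        using real_arch_pow[of 2 "max 1 (s + 1) / t"] by auto
      then have *: "1 \<le> 2 * (t * 2 ^ k)" "s < 2 * (t * 2 ^ k)"
        using \<open>0 < t\<close> s by (auto simp: field_simps)
      then have "s < (2 * (t * 2 ^ k)) powr 1"
        using assms by simp
      also have "\<dots> \<le> (2 * (t * 2 ^ k)) powr q"
        using * assms by (intro powr_mono) auto
      also have "(2 * (t * 2 ^ k)) powr q \<le> s"
        using term_le[of k] s top by simp
      finally show False
        by simp
    qed
    then show ?thesis
      by simp
  qed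
qed

section \<open>Powers, roots and comparison of power means\<close>

lemma epowr_le_iff:
  assumes "0 < a" "0 \<le> N"
  shows "epowr x (1 / a) \<le> ennreal N \<longleftrightarrow> x \<le> ennreal (N powr a)"
proof (cases x rule: ennreal_cases)
  case (real v)
  have "v powr (1 / a) \<le> N \<longleftrightarrow> v \<le> N powr a"
  proof
    assume "v powr (1 / a) \<le> N"
    then have "(v powr (1 / a)) powr a \<le> N powr a"
      using assms by (intro powr_mono2) auto
    then show "v \<le> N powr a"
      using assms real by (simp add: powr_powr)
  next
    assume "v \<le> N powr a"
    then have "v powr (1 / a) \<le> (N powr a) powr (1 / a)"
      using assms real by (intro powr_mono2) auto
    then show "v powr (1 / a) \<le> N"
      using assms by (simp add: powr_powr)
  qed
  then show ?thesis
    using real assms by (simp add: epowr_ennreal)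
qed (simp add: epowr_def top_unique)

lemma ennreal_mult_le_iff:
  assumes "0 < c" "0 \<le> z"
  shows "ennreal c * x \<le> ennreal z \<longleftrightarrow> x \<le> ennreal (z / c)"
proof (cases x rule: ennreal_cases)
  case (real v)
  then show ?thesis
    using assms by (simp add: field_simps flip: ennreal_mult)
qed (use assms in \<open>simp add: ennreal_mult_top top_unique\<close>)

text \<open>Up to \<open>t\<close> the first summand dominates. Above \<open>t\<close> the power
  with exponent \<open>a - b\<close> is at most \<open>t powr (a - b)\<close>, since this exponent
  is not positive, and the second summand dominates.\<close>

lemma epowr_le_powr_add:
  assumes "0 < t" "0 \<le> a" "a \<le> b"
  shows "epowr x a \<le> ennreal (t powr a) + ennreal (t powr (a - b)) * epowr x b"
proof (cases x rule: ennreal_cases)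
  case (real v)
  have "v powr a \<le> t powr a + t powr (a - b) * v powr b"
  proof (cases "v \<le> t")
    case True
    then have "v powr a \<le> t powr a"
      using real assms by (intro powr_mono2) auto
    then show ?thesis
      by (simp add: add_increasing2)
  next
    case False
    then have "v powr a = v powr (a - b) * v powr b"
      by (simp flip: powr_add)
    also have "\<dots> \<le> t powr (a - b) * v powr b"
      using False assms by (intro mult_right_mono powr_mono2') auto
    finally show ?thesis
      by (simp add: add_increasing)
  qed
  then show ?thesis
    using real by (simp add: epowr_ennreal flip: ennreal_mult ennreal_plus)
qed (use assms in \<open>simp add: epowr_def ennreal_mult_top\<close>)

text \<open>The factor 2 is the price of a pointwise inequality in place of Jensen's.\<close>

lemma upper_nn_integral_power_mean:
  assumes [measurable]: "B \<in> sets M" and "0 < t" "0 \<le> a" "a \<le> b"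
    and le: "upper_nn_integral M (\<lambda>y. epowr (F y) b * indicator B y) \<le> ennreal (t powr b) * emeasure M B"
  shows "upper_nn_integral M (\<lambda>y. epowr (F y) a * indicator B y) \<le> ennreal (2 * t powr a) * emeasure M B"
proof -
  have "upper_nn_integral M (\<lambda>y. epowr (F y) a * indicator B y) \<le>
      (\<integral>\<^sup>+y. ennreal (t powr a) * indicator B y \<partial>M) +
      ennreal (t powr (a - b)) * upper_nn_integral M (\<lambda>y. epowr (F y) b * indicator B y)"
    using epowr_le_powr_add[OF assms(2-4)]
    by (intro upper_nn_integral_affine_le) (auto simp: indicator_def)
  also have "\<dots> \<le> ennreal (t powr a) * emeasure M B +
      ennreal (t powr (a - b)) * (ennreal (t powr b) * emeasure M B)"
    by (intro add_mono mult_left_mono le) (auto simp: nn_integral_cmult_indicator)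
  also have "\<dots> = (ennreal (t powr a) + ennreal (t powr (a - b) * t powr b)) * emeasure M B"
    by (simp add: distrib_right ennreal_mult mult.assoc)
  also have "ennreal (t powr a) + ennreal (t powr (a - b) * t powr b) = ennreal (2 * t powr a)"
    using assms(2) by (simp flip: powr_add ennreal_plus)
  finally show ?thesis .
qed

subsection \<open>Quasi-balls and coverings\<close>

context homogeneous_type_space
begin

text \<open>Since \<open>\<rho>\<close> is bounded, the whole space is a single ball.\<close>

lemma finite_measure_M: "finite_measure M"
proof
  obtain x :: 'a where True by simp
  obtain b where b: "\<And>x y. \<rho> x y \<le> b"
    using finite_diameter by (auto simp: bdd_above_def)
  have "UNIV \<subseteq> qball \<rho> x (\<bar>b\<bar> + 1)"
    using b[of x] by (auto simp: qball_def intro: le_less_trans[OF b])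
  moreover have "emeasure M (qball \<rho> x (\<bar>b\<bar> + 1)) < \<infinity>"
    by (rule qball_finite) simp
  ultimately show "emeasure M (space M) \<noteq> \<infinity>"
    by (metis space_UNIV less_irrefl top.extremum_uniqueI)
qed

sublocale finite_measure M
  by (rule finite_measure_M)

lemma measure_qball_pos: "0 < r \<Longrightarrow> 0 < measure M (qball \<rho> x r)"
  using qball_pos[of r x] by (simp add: emeasure_eq_measure)

lemma rho_le_qdiam: "\<rho> x y \<le> qdiam \<rho>"
  unfolding qdiam_def using cSUP_upper[OF _ finite_diameter, of "(x, y)"] by simp

lemma qball_eq_UNIV: "qdiam \<rho> < r \<Longrightarrow> qball \<rho> x r = UNIV"
  using rho_le_qdiam by (auto simp: qball_def intro: le_less_trans)

lemma qball_mono: "r \<le> s \<Longrightarrow> qball \<rho> x r \<subseteq> qball \<rho> x s"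
  by (auto simp: qball_def)

lemma centre_in_qball: "0 < r \<Longrightarrow> x \<in> qball \<rho> x r"
  by (simp add: qball_def rho_eq_0_iff[THEN iffD2])

lemma measure_qball_mono:
  assumes "qball \<rho> x r \<subseteq> qball \<rho> y s" "0 < s"
  shows "measure M (qball \<rho> x r) \<le> measure M (qball \<rho> y s)"
  using assms by (intro finite_measure_mono qball_measurable)

text \<open>Doubling is iterated \<open>n\<close> times with \<open>K < 2 ^ n\<close>, so
  \<open>D\<close> depends on \<open>K\<close> alone. The maximum with 1 in the witness lets later
  estimates use \<open>D powr a \<le> D\<close> for \<open>a \<le> 1\<close>.\<close>

lemma doubling_scaled:
  obtains D where "1 \<le> D"
    "\<And>x r. 0 < r \<Longrightarrow> measure M (qball \<rho> x (K * r)) \<le> D * measure M (qball \<rho> x r)"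
proof -
  obtain c where c: "0 < c" and
    "\<And>x r. 0 < r \<Longrightarrow> emeasure M (qball \<rho> x (2 * r)) \<le> ennreal c * emeasure M (qball \<rho> x r)"
    using doubling by auto
  then have double: "measure M (qball \<rho> x (2 * r)) \<le> c * measure M (qball \<rho> x r)" if "0 < r" for x r
    using that by (simp add: emeasure_eq_measure flip: ennreal_mult)
  have iter: "measure M (qball \<rho> x (2 ^ n * r)) \<le> c ^ n * measure M (qball \<rho> x r)"
    if "0 < r" for x r and n :: nat
  proof (induction n)
    case (Suc n)
    have "measure M (qball \<rho> x (2 ^ Suc n * r)) \<le> c * measure M (qball \<rho> x (2 ^ n * r))"
      using double[of "2 ^ n * r" x] that by (simp add: mult.assoc)
    also have "\<dots> \<le> c * (c ^ n * measure M (qball \<rho> x r))"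
      using Suc c by simp
    finally show ?case
      by (simp add: mult_ac)
  qed simp
  obtain n where n: "K < 2 ^ n"
    using real_arch_pow[of 2 K] by auto
  have "measure M (qball \<rho> x (K * r)) \<le> max 1 (c ^ n) * measure M (qball \<rho> x r)" if "0 < r" for x r
  proof -
    have "measure M (qball \<rho> x (K * r)) \<le> measure M (qball \<rho> x (2 ^ n * r))"
      using n that by (intro measure_qball_mono qball_mono mult_right_mono) auto
    also have "\<dots> \<le> c ^ n * measure M (qball \<rho> x r)"
      by (rule iter[OF that])
    also have "\<dots> \<le> max 1 (c ^ n) * measure M (qball \<rho> x r)"
      by (intro mult_right_mono) auto
    finally show ?thesis .
  qed
  then show thesis
    by (intro that[of "max 1 (c ^ n)"]) auto
qed

text \<open>The first property serves the Vitali covering, where only centres have to be covered.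
  The second localises averages over small balls; the third compares the measure of a large ball
  with that of a smaller ball containing its centre.\<close>

lemma qball_engulfing:
  obtains K where "1 \<le> K"
    "\<And>x y r s. qball \<rho> x r \<inter> qball \<rho> y s \<noteq> {} \<Longrightarrow> r \<le> 2 * s \<Longrightarrow> x \<in> qball \<rho> y (K * s)"
    "\<And>x y r s. y \<in> qball \<rho> x r \<Longrightarrow> s \<le> r \<Longrightarrow> qball \<rho> y s \<subseteq> qball \<rho> x (K * r)"
    "\<And>x y r s. y \<in> qball \<rho> x r \<Longrightarrow> r \<le> s \<Longrightarrow> qball \<rho> x r \<subseteq> qball \<rho> y (K * s)"
proof -
  obtain a1 where a1: "0 < a1" and tri: "\<And>x y z. \<rho> x y \<le> a1 * (\<rho> x z + \<rho> z y)"
    using quasi_triangle by auto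
  obtain a0 where a0: "0 < a0" and sym: "\<And>x y. \<rho> x y \<le> a0 * \<rho> y x"
    using quasi_symmetric by auto
  \<comment> \<open>Each distance is at most \<open>a1 * (u + v)\<close>, where for the radius
    \<open>s\<close> to be dilated \<open>v \<le> s\<close> and \<open>u\<close> is at most
    \<open>2 * a0 * s\<close>, \<open>s\<close> or \<open>a0 * s\<close>. This gives at most
    \<open>2 * a1 * (1 + a0) * s\<close>; the added 1 makes the inequality strict and
    \<open>K\<close> at least 1.\<close>
  define K where "K = 1 + 2 * a1 * (1 + a0)"
  have less_K: "a1 * (u + v) < K * s" if "u \<le> (1 + 2 * a0) * s" "v \<le> s" "0 < s" for u v s
  proof -
    have "a1 * (u + v) \<le> a1 * (2 * (1 + a0) * s)"
      using that a1 by (intro mult_left_mono) (auto simp: algebra_simps)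
    also have "\<dots> < K * s"
      using \<open>0 < s\<close> by (simp add: K_def algebra_simps)
    finally show ?thesis .
  qed
  show thesis
  proof
    show "1 \<le> K"
      using a0 a1 by (simp add: K_def)
  next
    fix x y r s assume "qball \<rho> x r \<inter> qball \<rho> y s \<noteq> {}" "r \<le> 2 * s"
    then obtain w where w: "\<rho> x w < r" "\<rho> y w < s"
      by (auto simp: qball_def)
    have "\<rho> w x \<le> a0 * (2 * s)"
      using sym[of w x] w(1) \<open>r \<le> 2 * s\<close> a0 by (smt (verit) mult_left_mono)
    moreover have "0 < s"
      using w rho_nonneg[of y w] by linarith
    ultimately have "a1 * (\<rho> w x + \<rho> y w) < K * s"
      using w(2) by (intro less_K) (auto simp: algebra_simps)
    then show "x \<in> qball \<rho> y (K * s)"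
      using tri[of y x w] by (simp add: qball_def add.commute)
  next
    fix x y r s assume y: "y \<in> qball \<rho> x r" and "s \<le> r"
    have "0 < r"
      using y rho_nonneg[of x y] by (simp add: qball_def)
    then have "1 * r \<le> (1 + 2 * a0) * r"
      using a0 by (intro mult_right_mono) auto
    then have xy: "\<rho> x y \<le> (1 + 2 * a0) * r"
      using y by (simp add: qball_def)
    show "qball \<rho> y s \<subseteq> qball \<rho> x (K * r)"
    proof
      fix z assume "z \<in> qball \<rho> y s"
      then have "a1 * (\<rho> x y + \<rho> y z) < K * r"
        using y \<open>s \<le> r\<close> \<open>0 < r\<close> xy by (intro less_K) (auto simp: qball_def)
      then show "z \<in> qball \<rho> x (K * r)"
        using tri[of x z y] by (simp add: qball_def)
    qed
  next
    fix x y r s assume y: "y \<in> qball \<rho> x r" and "r \<le> s"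
    have "0 < s"
      using y \<open>r \<le> s\<close> rho_nonneg[of x y] by (simp add: qball_def)
    have "\<rho> y x \<le> a0 * s"
      using sym[of y x] y \<open>r \<le> s\<close> a0 by (smt (verit) mult_left_mono qball_def mem_Collect_eq)
    moreover have "a0 * s \<le> (1 + 2 * a0) * s"
      using \<open>0 < s\<close> a0 by (intro mult_right_mono) auto
    ultimately have *: "\<rho> y x \<le> (1 + 2 * a0) * s"
      by simp
    show "qball \<rho> x r \<subseteq> qball \<rho> y (K * s)"
    proof
      fix z assume "z \<in> qball \<rho> x r"
      then have "a1 * (\<rho> y x + \<rho> x z) < K * s"
        using * \<open>r \<le> s\<close> \<open>0 < s\<close> by (intro less_K) (auto simp: qball_def)
      then show "z \<in> qball \<rho> y (K * s)"
        using tri[of y z x] by (simp add: qball_def)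
    qed
  qed
qed

section \<open>Vitali coverings by quasi-balls and sums over them\<close>

text \<open>The total measure bounds all finite sums of measures of disjoint balls, so only
  countably many of these measures are nonzero; and each of them is positive.\<close>

lemma countable_disjoint_qballs:
  assumes "disjoint_family_on (\<lambda>z. qball \<rho> z (r z)) S" "\<And>z. z \<in> S \<Longrightarrow> 0 < r z"
  shows "countable S"
proof -
  let ?m = "\<lambda>z. measure M (qball \<rho> z (r z))"
  have "?m summable_on S"
  proof (rule nonneg_bdd_above_summable_on)
    show "bdd_above (sum ?m ` {F. F \<subseteq> S \<and> finite F})"
    proof (rule bdd_aboveI2)
      fix F assume F: "F \<in> {F. F \<subseteq> S \<and> finite F}"
      have "sum ?m F = measure M (\<Union>z\<in>F. qball \<rho> z (r z))"
        using F assms by (intro finite_measure_finite_Union[symmetric])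
          (auto intro!: qball_measurable simp: emeasure_eq_measure intro: disjoint_family_on_mono)
      also have "\<dots> \<le> measure M (space M)"
        by (rule bounded_measure)
      finally show "sum ?m F \<le> measure M (space M)" .
    qed
  qed simp
  then have "countable {z\<in>S. ?m z \<noteq> 0}"
    by (rule summable_countable_real)
  moreover have "?m z \<noteq> 0" if "z \<in> S" for z
    using measure_qball_pos[OF assms(2)[OF that], of z] by simp
  then have "{z\<in>S. ?m z \<noteq> 0} = S"
    by auto
  ultimately show ?thesis
    by simp
qed

text \<open>The ratio 2 of the selection is the one in the first engulfing property.
  \<open>K\<close> is fixed before \<open>A\<close> and the radii, so constants derived from it are
  uniform.\<close>

lemma Vitali_covering_qball:
  obtains K where "1 \<le> K"
    "\<And>A r. (\<And>y. y \<in> A \<Longrightarrow> 0 < r y) \<Longrightarrow> bdd_above (r ` A) \<Longrightarrow>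
      \<exists>S\<subseteq>A. countable S \<and> disjoint_family_on (\<lambda>z. qball \<rho> z (r z)) S \<and>
        A \<subseteq> (\<Union>z\<in>S. qball \<rho> z (K * r z))"
proof -
  obtain K where K: "1 \<le> K"
    "\<And>x y r s. qball \<rho> x r \<inter> qball \<rho> y s \<noteq> {} \<Longrightarrow> r \<le> 2 * s \<Longrightarrow> x \<in> qball \<rho> y (K * s)"
    by (rule qball_engulfing) blast
  have "\<exists>S\<subseteq>A. countable S \<and> disjoint_family_on (\<lambda>z. qball \<rho> z (r z)) S \<and>
        A \<subseteq> (\<Union>z\<in>S. qball \<rho> z (K * r z))"
    if pos: "\<And>y. y \<in> A \<Longrightarrow> 0 < r y" and bdd: "bdd_above (r ` A)" for A :: "'a set" and r
  proof -
    obtain S where S: "S \<subseteq> A" "disjoint_family_on (\<lambda>z. qball \<rho> z (r z)) S"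
      "\<And>y. y \<in> A \<Longrightarrow> \<exists>z\<in>S. qball \<rho> y (r y) \<inter> qball \<rho> z (r z) \<noteq> {} \<and> r y \<le> 2 * r z"
    proof (rule Vitali_selection[of A r "\<lambda>z. qball \<rho> z (r z)"])
      show "qball \<rho> y (r y) \<noteq> {}" if "y \<in> A" for y
        using centre_in_qball[OF pos[OF that]] by blast
    qed (use pos bdd in auto)
    then have "A \<subseteq> (\<Union>z\<in>S. qball \<rho> z (K * r z))"
      using K(2) by blast
    moreover have "countable S"
      using S(1,2) pos by (intro countable_disjoint_qballs) auto
    ultimately show ?thesis
      using S by blast
  qed
  with K(1) show thesis
    by (rule that)
qed

text \<open>Countable additivity of \<open>density M F\<close>. The sum over \<open>S\<close> is
  written as an integral over \<open>count_space S\<close>, which avoids enumerating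
  \<open>S\<close>.\<close>

lemma nn_integral_disjoint_le:
  assumes [measurable]: "F \<in> borel_measurable M" and "countable S"
    and meas: "\<And>z. z \<in> S \<Longrightarrow> B z \<in> sets M" and disj: "disjoint_family_on B S"
  shows "(\<integral>\<^sup>+z. (\<integral>\<^sup>+y\<in>B z. F y \<partial>M) \<partial>count_space S) \<le> (\<integral>\<^sup>+y. F y \<partial>M)"
proof -
  have "(\<integral>\<^sup>+z. (\<integral>\<^sup>+y\<in>B z. F y \<partial>M) \<partial>count_space S) =
      (\<integral>\<^sup>+z. emeasure (density M F) (B z) \<partial>count_space S)"
    using meas by (intro nn_integral_cong) (auto simp: emeasure_density)
  also have "\<dots> = emeasure (density M F) (\<Union>z\<in>S. B z)"
    using assms by (intro emeasure_UN_countable[symmetric]) auto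
  also have "\<dots> \<le> emeasure (density M F) (space (density M F))"
    by (rule emeasure_space)
  also have "\<dots> = (\<integral>\<^sup>+y. F y \<partial>M)"
    using emeasure_density[of F M "space M"] sets.top[of M] by (simp add: space_UNIV)
  finally show ?thesis .
qed

text \<open>The value at a point of \<open>A\<close> already occurs as one term of the sum; sum and
  integral are then interchanged, \<open>S\<close> being countable.\<close>

lemma nn_integral_cover_le:
  assumes [measurable]: "F \<in> borel_measurable M" and "countable S"
    and meas: "\<And>z. z \<in> S \<Longrightarrow> B z \<in> sets M" and A: "A \<subseteq> (\<Union>z\<in>S. B z)"
  shows "(\<integral>\<^sup>+y\<in>A. F y \<partial>M) \<le> (\<integral>\<^sup>+z. (\<integral>\<^sup>+y\<in>B z. F y \<partial>M) \<partial>count_space S)"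
proof -
  have "(\<integral>\<^sup>+y\<in>A. F y \<partial>M) \<le> (\<integral>\<^sup>+y. (\<integral>\<^sup>+z. F y * indicator (B z) y \<partial>count_space S) \<partial>M)"
  proof (rule nn_integral_mono)
    fix y
    show "F y * indicator A y \<le> (\<integral>\<^sup>+z. F y * indicator (B z) y \<partial>count_space S)"
    proof (cases "y \<in> A")
      case True
      then obtain z where z: "z \<in> S" "y \<in> B z"
        using A by blast
      then have "F y * indicator A y = (\<integral>\<^sup>+w. F y * indicator (B w) y * indicator {z} w \<partial>count_space S)"
        using True by (subst nn_integral_indicator_singleton) auto
      also have "\<dots> \<le> (\<integral>\<^sup>+z. F y * indicator (B z) y \<partial>count_space S)"
        by (intro nn_integral_mono) (simp add: indicator_def)
      finally show ?thesis .
    qed simp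
  qed
  also have "\<dots> = (\<integral>\<^sup>+z. (\<integral>\<^sup>+y\<in>B z. F y \<partial>M) \<partial>count_space S)"
    using assms by (intro nn_integral_count_space_nn_integral) auto
  finally show ?thesis .
qed

subsection \<open>The weak and strong type estimates\<close>

text \<open>Balls have positive finite measure, so the division in the averages can be
  cleared.\<close>

lemma hl_maximal_le_iff:
  "hl_maximal M \<rho> f x \<le> t \<longleftrightarrow> (\<forall>r\<in>{0<..<qdiam \<rho>}.
     (\<integral>\<^sup>+y\<in>qball \<rho> x r. ennreal \<bar>f y\<bar> \<partial>M) \<le> t * emeasure M (qball \<rho> x r))"
proof -
  have "(a / emeasure M (qball \<rho> x r) \<le> t) = (a \<le> t * emeasure M (qball \<rho> x r))"
    if "0 < r" for r a
    using qball_pos[OF that, of x] qball_finite[OF that, of x]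
    by (intro divide_le_iff_ennreal) auto
  then show ?thesis
    by (auto simp: hl_maximal_def SUP_le_iff)
qed

text \<open>The superlevel sets of the maximal function need not be measurable, so the estimate is stated
  for a measurable superset.\<close>

lemma hl_maximal_weak_type:
  obtains C where "1 \<le> C"
    "\<And>f t. f \<in> borel_measurable M \<Longrightarrow> 0 < t \<Longrightarrow> \<exists>E\<in>sets M. {y. ennreal t < hl_maximal M \<rho> f y} \<subseteq> E \<and>
       ennreal t * emeasure M E \<le> ennreal C * (\<integral>\<^sup>+y. ennreal \<bar>f y\<bar> \<partial>M)"
proof -
  obtain K where K: "1 \<le> K" and cover: "\<And>A r. (\<And>y. y \<in> A \<Longrightarrow> 0 < r y) \<Longrightarrow> bdd_above (r ` A) \<Longrightarrow>
      \<exists>S\<subseteq>A. countable S \<and> disjoint_family_on (\<lambda>z. qball \<rho> z (r z)) S \<and>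
        A \<subseteq> (\<Union>z\<in>S. qball \<rho> z (K * r z))"
    by (rule Vitali_covering_qball) blast
  obtain D where D: "1 \<le> D"
    "\<And>x r. 0 < r \<Longrightarrow> measure M (qball \<rho> x (K * r)) \<le> D * measure M (qball \<rho> x r)"
    by (rule doubling_scaled) blast
  show thesis
  proof (rule that[OF D(1)])
    fix f :: "'a \<Rightarrow> real" and t :: real
    assume [measurable]: "f \<in> borel_measurable M" and "0 < t"
    define A where "A = {y. ennreal t < hl_maximal M \<rho> f y}"
    have "\<forall>y\<in>A. \<exists>r. 0 < r \<and> r < qdiam \<rho> \<and>
      ennreal t * emeasure M (qball \<rho> y r) \<le> (\<integral>\<^sup>+w\<in>qball \<rho> y r. ennreal \<bar>f w\<bar> \<partial>M)"
    proof
      fix y assume "y \<in> A"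
      then have "\<not> hl_maximal M \<rho> f y \<le> ennreal t"
        by (simp add: A_def)
      then show "\<exists>r. 0 < r \<and> r < qdiam \<rho> \<and>
      ennreal t * emeasure M (qball \<rho> y r) \<le> (\<integral>\<^sup>+w\<in>qball \<rho> y r. ennreal \<bar>f w\<bar> \<partial>M)"
        unfolding hl_maximal_le_iff by (auto simp: not_le intro: less_imp_le)
    qed
    then obtain r where r: "\<And>y. y \<in> A \<Longrightarrow> 0 < r y" "\<And>y. y \<in> A \<Longrightarrow> r y < qdiam \<rho>"
      "\<And>y. y \<in> A \<Longrightarrow> ennreal t * emeasure M (qball \<rho> y (r y)) \<le>
         (\<integral>\<^sup>+w\<in>qball \<rho> y (r y). ennreal \<bar>f w\<bar> \<partial>M)"
      by metis
    have "bdd_above (r ` A)"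
      using r(2) by (intro bdd_aboveI2[of _ _ "qdiam \<rho>"]) (auto intro: less_imp_le)
    then obtain S where S: "S \<subseteq> A" "countable S"
        "disjoint_family_on (\<lambda>z. qball \<rho> z (r z)) S" "A \<subseteq> (\<Union>z\<in>S. qball \<rho> z (K * r z))"
      using cover[of A r] r(1) by auto
    have meas: "qball \<rho> z (r z) \<in> sets M" "qball \<rho> z (K * r z) \<in> sets M" if "z \<in> S" for z
      using that S(1) r(1) K by (auto intro!: qball_measurable mult_pos_pos)
    \<comment> \<open>A countable union of balls is measurable, whatever the superlevel set
      \<open>A\<close> is like.\<close>
    define E where "E = (\<Union>z\<in>S. qball \<rho> z (K * r z))"
    have E: "E \<in> sets M"
      unfolding E_def using S(2) meas by auto
    have "ennreal t * emeasure M E = (\<integral>\<^sup>+y\<in>E. ennreal t \<partial>M)"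
      using E by (simp add: nn_integral_cmult_indicator)
    also have "\<dots> \<le> (\<integral>\<^sup>+z. (\<integral>\<^sup>+y\<in>qball \<rho> z (K * r z). ennreal t \<partial>M) \<partial>count_space S)"
      using S(2) meas(2) unfolding E_def by (intro nn_integral_cover_le) auto
    \<comment> \<open>Doubling passes from the covering ball to the selected one at the cost of
      \<open>D\<close>; there the choice of the radius bounds \<open>t\<close> times the measure by
      the integral.\<close>
    also have "\<dots> \<le> (\<integral>\<^sup>+z. ennreal D * (\<integral>\<^sup>+w\<in>qball \<rho> z (r z). ennreal \<bar>f w\<bar> \<partial>M) \<partial>count_space S)"
    proof (rule nn_integral_mono)
      fix z assume "z \<in> space (count_space S)"
      then have z: "z \<in> S" "z \<in> A" using S(1) by auto
      have "(\<integral>\<^sup>+y\<in>qball \<rho> z (K * r z). ennreal t \<partial>M) = ennreal t * emeasure M (qball \<rho> z (K * r z))"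
        using meas[OF z(1)] by (simp add: nn_integral_cmult_indicator)
      also have "\<dots> \<le> ennreal t * (ennreal D * emeasure M (qball \<rho> z (r z)))"
        using D(2)[OF r(1)[OF z(2)], of z] D(1)
        by (intro mult_left_mono) (auto simp: emeasure_eq_measure simp flip: ennreal_mult)
      also have "\<dots> = ennreal D * (ennreal t * emeasure M (qball \<rho> z (r z)))"
        by (simp add: mult_ac)
      also have "\<dots> \<le> ennreal D * (\<integral>\<^sup>+w\<in>qball \<rho> z (r z). ennreal \<bar>f w\<bar> \<partial>M)"
        by (intro mult_left_mono r z) auto
      finally show "(\<integral>\<^sup>+y\<in>qball \<rho> z (K * r z). ennreal t \<partial>M) \<le>
         ennreal D * (\<integral>\<^sup>+w\<in>qball \<rho> z (r z). ennreal \<bar>f w\<bar> \<partial>M)" .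
    qed
    also have "\<dots> = ennreal D * (\<integral>\<^sup>+z. (\<integral>\<^sup>+w\<in>qball \<rho> z (r z). ennreal \<bar>f w\<bar> \<partial>M) \<partial>count_space S)"
      by (simp add: nn_integral_cmult)
    also have "\<dots> \<le> ennreal D * (\<integral>\<^sup>+y. ennreal \<bar>f y\<bar> \<partial>M)"
      using S meas by (intro mult_left_mono nn_integral_disjoint_le) auto
    finally show "\<exists>E\<in>sets M. {y. ennreal t < hl_maximal M \<rho> f y} \<subseteq> E \<and>
       ennreal t * emeasure M E \<le> ennreal D * (\<integral>\<^sup>+y. ennreal \<bar>f y\<bar> \<partial>M)"
      using E S(4) by (auto simp: A_def E_def)
  qed
qed

text \<open>Values of size at most \<open>t / 2\<close> contribute at most \<open>t / 2\<close> to
  every average, so the maximal function of \<open>f\<close> exceeds \<open>t\<close> only where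
  that of the remaining part \<open>g\<close> exceeds \<open>t / 2\<close>. Using the weak estimate
  at \<open>t / 2\<close> doubles the constant. With only large values on the right, the sum over
  dyadic levels in the interpolation converges.\<close>

lemma hl_maximal_weak_type_truncated:
  obtains C where "1 \<le> C"
    "\<And>f t. f \<in> borel_measurable M \<Longrightarrow> 0 < t \<Longrightarrow> \<exists>E\<in>sets M. {y. ennreal t < hl_maximal M \<rho> f y} \<subseteq> E \<and>
       ennreal t * emeasure M E \<le> ennreal C * (\<integral>\<^sup>+y. ennreal (if t < 2 * \<bar>f y\<bar> then \<bar>f y\<bar> else 0) \<partial>M)"
proof -
  obtain C where C: "1 \<le> C"
    "\<And>f t. f \<in> borel_measurable M \<Longrightarrow> 0 < t \<Longrightarrow> \<exists>E\<in>sets M. {y. ennreal t < hl_maximal M \<rho> f y} \<subseteq> E \<and>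
       ennreal t * emeasure M E \<le> ennreal C * (\<integral>\<^sup>+y. ennreal \<bar>f y\<bar> \<partial>M)"
    by (rule hl_maximal_weak_type) blast
  show thesis
  proof (rule that[of "2 * C"])
    fix f :: "'a \<Rightarrow> real" and t :: real
    assume [measurable]: "f \<in> borel_measurable M" and t: "0 < t"
    define g where "g y = (if t < 2 * \<bar>f y\<bar> then f y else 0)" for y
    have [measurable]: "g \<in> borel_measurable M"
      unfolding g_def by measurable
    obtain E where E: "E \<in> sets M" "{y. ennreal (t / 2) < hl_maximal M \<rho> g y} \<subseteq> E"
       "ennreal (t / 2) * emeasure M E \<le> ennreal C * (\<integral>\<^sup>+y. ennreal \<bar>g y\<bar> \<partial>M)"
      using C(2)[of g "t / 2"] t by auto
    have "hl_maximal M \<rho> f y \<le> ennreal t" if "hl_maximal M \<rho> g y \<le> ennreal (t / 2)" for y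
      unfolding hl_maximal_le_iff
    proof
      fix r assume r: "r \<in> {0<..<qdiam \<rho>}"
      then have [measurable]: "qball \<rho> y r \<in> sets M"
        by (intro qball_measurable) simp
      have "(\<integral>\<^sup>+w\<in>qball \<rho> y r. ennreal \<bar>f w\<bar> \<partial>M) \<le>
          (\<integral>\<^sup>+w. ennreal (t / 2) * indicator (qball \<rho> y r) w + ennreal \<bar>g w\<bar> * indicator (qball \<rho> y r) w \<partial>M)"
        using t by (intro nn_integral_mono) (auto simp: g_def indicator_def intro!: ennreal_leI simp flip: ennreal_plus)
      also have "\<dots> = ennreal (t / 2) * emeasure M (qball \<rho> y r) + (\<integral>\<^sup>+w\<in>qball \<rho> y r. ennreal \<bar>g w\<bar> \<partial>M)"
        by (simp add: nn_integral_add nn_integral_cmult_indicator)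
      also have "\<dots> \<le> ennreal (t / 2) * emeasure M (qball \<rho> y r) + ennreal (t / 2) * emeasure M (qball \<rho> y r)"
        using that r unfolding hl_maximal_le_iff by (intro add_left_mono) auto
      also have "\<dots> = ennreal t * emeasure M (qball \<rho> y r)"
        using t by (simp flip: distrib_right ennreal_plus)
      finally show "(\<integral>\<^sup>+w\<in>qball \<rho> y r. ennreal \<bar>f w\<bar> \<partial>M) \<le> ennreal t * emeasure M (qball \<rho> y r)" .
    qed
    then have sub: "{y. ennreal t < hl_maximal M \<rho> f y} \<subseteq> E"
      using E(2) by (auto simp: not_le[symmetric])
    have "ennreal t * emeasure M E = 2 * (ennreal (t / 2) * emeasure M E)"
      using t by (simp add: mult.assoc[symmetric] ennreal_mult'[symmetric] flip: ennreal_numeral)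
    also have "\<dots> \<le> 2 * (ennreal C * (\<integral>\<^sup>+y. ennreal \<bar>g y\<bar> \<partial>M))"
      by (intro mult_left_mono E) auto
    also have "\<dots> = ennreal (2 * C) * (\<integral>\<^sup>+y. ennreal (if t < 2 * \<bar>f y\<bar> then \<bar>f y\<bar> else 0) \<partial>M)"
      by (simp add: g_def if_distrib[of abs] ennreal_mult' mult.assoc cong: if_cong)
    finally show "\<exists>E\<in>sets M. {y. ennreal t < hl_maximal M \<rho> f y} \<subseteq> E \<and>
       ennreal t * emeasure M E \<le> ennreal (2 * C) * (\<integral>\<^sup>+y. ennreal (if t < 2 * \<bar>f y\<bar> then \<bar>f y\<bar> else 0) \<partial>M)"
      using E(1) sub by blast
  qed (use C(1) in simp)
qed

text \<open>Marcinkiewicz interpolation between the weak type estimate and the trivial \<open>L\<^sup>\<infinity>\<close> bound,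
  carried out on the dyadic levels \<open>t * 2 ^ k\<close> with \<open>t \<rightarrow> 0\<close>.\<close>

lemma hl_maximal_strong_type:
  assumes "1 < q0"
  obtains A where "1 \<le> A"
    "\<And>f q. f \<in> borel_measurable M \<Longrightarrow> q0 \<le> q \<Longrightarrow> q \<le> p \<Longrightarrow>
       upper_nn_integral M (\<lambda>y. epowr (hl_maximal M \<rho> f y) q) \<le>
       ennreal A * (\<integral>\<^sup>+y. ennreal (\<bar>f y\<bar> powr q) \<partial>M)"
proof -
  obtain C where C: "1 \<le> C"
    "\<And>f t. f \<in> borel_measurable M \<Longrightarrow> 0 < t \<Longrightarrow> \<exists>E\<in>sets M. {y. ennreal t < hl_maximal M \<rho> f y} \<subseteq> E \<and>
       ennreal t * emeasure M E \<le> ennreal C * (\<integral>\<^sup>+y. ennreal (if t < 2 * \<bar>f y\<bar> then \<bar>f y\<bar> else 0) \<partial>M)"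
    by (rule hl_maximal_weak_type_truncated) blast
  \<comment> \<open>The interpolation constant at \<open>q\<close> is
    \<open>2 powr q * C * 4 powr (q - 1) / (2 powr (q - 1) - 1)\<close>. For all \<open>q\<close>
    between \<open>q0\<close> and \<open>p\<close> it is bounded by raising the exponents in the
    numerator to \<open>p\<close> and taking the denominator at \<open>q0\<close>, where it is
    smallest.\<close>
  define A where "A = max 1 (2 powr p * C * 4 powr p / (2 powr (q0 - 1) - 1))"
  show thesis
  proof (rule that[of A])
    show "1 \<le> A"
      by (simp add: A_def)
  next
    fix f :: "'a \<Rightarrow> real" and q
    assume [measurable]: "f \<in> borel_measurable M" and q: "q0 \<le> q" "q \<le> p"
    have "1 < q"
      using q assms by simp
    have A_ge: "2 powr q * C * (4 powr (q - 1) / (2 powr (q - 1) - 1)) \<le> A"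
    proof -
      have "2 powr (q0 - 1) \<le> (2::real) powr (q - 1)" "1 < (2::real) powr (q0 - 1)"
        using q assms by (auto intro: powr_mono)
      then have "2 powr q * C * (4 powr (q - 1) / (2 powr (q - 1) - 1)) \<le>
          2 powr p * C * (4 powr p / (2 powr (q0 - 1) - 1))"
        using q C(1) assms
        by (intro mult_mono frac_le powr_mono) (auto intro!: divide_nonneg_nonneg ge_one_powr_ge_zero)
      then show ?thesis
        by (simp add: A_def)
    qed
    let ?F = "hl_maximal M \<rho> f" and ?I = "\<integral>\<^sup>+y. ennreal (\<bar>f y\<bar> powr q) \<partial>M"
    \<comment> \<open>Values of the maximal function up to \<open>t\<close> contribute at most
      \<open>t powr q\<close> times the total measure, which is finite, so the error disappears as
      \<open>t\<close> tends to 0.\<close>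
    have level: "upper_nn_integral M (\<lambda>y. epowr (?F y) q) \<le>
        ennreal A * ?I + ennreal (t powr q * measure M (space M))"
      if t: "0 < t" for t
    proof -
      define s where "s k = t * 2 ^ k" for k :: nat
      have s_pos: "0 < s k" for k
        using t by (simp add: s_def)
      have "\<forall>k. \<exists>E. E \<in> sets M \<and> {y. ennreal (s k) < ?F y} \<subseteq> E \<and>
         ennreal (s k) * emeasure M E \<le>
           ennreal C * (\<integral>\<^sup>+y. ennreal (if s k < 2 * \<bar>f y\<bar> then \<bar>f y\<bar> else 0) \<partial>M)"
        using C(2)[of f] s_pos by (auto simp: Bex_def)
      from choice[OF this] obtain E where E[measurable]: "\<And>k. E k \<in> sets M" and sub: "\<And>k. {y. ennreal (s k) < ?F y} \<subseteq> E k"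
        and weak: "\<And>k. ennreal (s k) * emeasure M (E k) \<le>
           ennreal C * (\<integral>\<^sup>+y. ennreal (if s k < 2 * \<bar>f y\<bar> then \<bar>f y\<bar> else 0) \<partial>M)"
        by auto
      let ?G = "\<lambda>k y. ennreal ((2 * s k) powr q) * indicator (E k) y"
      let ?H = "\<lambda>k y. ennreal (2 powr q * C * \<bar>f y\<bar> * (if s k < 2 * \<bar>f y\<bar> then s k powr (q - 1) else 0))"
      have GH: "(\<integral>\<^sup>+y. ?G k y \<partial>M) \<le> (\<integral>\<^sup>+y. ?H k y \<partial>M)" for k
      proof -
        \<comment> \<open>One factor \<open>s k\<close> is spent on the weak type estimate; the
          power \<open>q - 1 > 0\<close> is left for the geometric sum.\<close>
        have split: "(2 * s k) powr q = 2 powr q * s k powr (q - 1) * s k"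
          using s_pos[of k] by (simp add: powr_mult powr_diff)
        have "(\<integral>\<^sup>+y. ?G k y \<partial>M) = ennreal (2 powr q * s k powr (q - 1)) * (ennreal (s k) * emeasure M (E k))"
          using s_pos[of k] unfolding split
          by (subst nn_integral_cmult_indicator) (simp_all add: mult.assoc ennreal_mult)
        also have "\<dots> \<le> ennreal (2 powr q * s k powr (q - 1)) *
            (ennreal C * (\<integral>\<^sup>+y. ennreal (if s k < 2 * \<bar>f y\<bar> then \<bar>f y\<bar> else 0) \<partial>M))"
          by (intro mult_left_mono weak) auto
        also have "\<dots> = (\<integral>\<^sup>+y. ennreal (2 powr q * s k powr (q - 1)) *
            (ennreal C * ennreal (if s k < 2 * \<bar>f y\<bar> then \<bar>f y\<bar> else 0)) \<partial>M)"
          by (simp add: nn_integral_cmult)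
        also have "\<dots> = (\<integral>\<^sup>+y. ?H k y \<partial>M)"
          using C(1) by (intro nn_integral_cong) (auto simp: mult_ac simp flip: ennreal_mult)
        finally show ?thesis .
      qed
      \<comment> \<open>For fixed \<open>y\<close> only levels below
        \<open>u = 2 * \<bar>f y\<bar>\<close> contribute, and the geometric bound in
        \<open>2 * u\<close> produces the factor \<open>4 powr (q - 1)\<close>.\<close>
      have H: "(\<Sum>k. ?H k y) \<le> ennreal A * ennreal (\<bar>f y\<bar> powr q)" for y
      proof -
        have "(\<Sum>k. ?H k y) = (\<Sum>k. ennreal (2 powr q * C * \<bar>f y\<bar>) *
            ennreal (if s k < 2 * \<bar>f y\<bar> then s k powr (q - 1) else 0))"
          using C(1) by (intro suminf_cong ennreal_mult) auto
        also have "\<dots> = ennreal (2 powr q * C * \<bar>f y\<bar>) *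
            (\<Sum>k. ennreal (if s k < 2 * \<bar>f y\<bar> then s k powr (q - 1) else 0))"
          by (rule ennreal_suminf_cmult)
        also have "\<dots> \<le> ennreal (2 powr q * C * \<bar>f y\<bar>) *
            ennreal ((2 * (2 * \<bar>f y\<bar>)) powr (q - 1) / (2 powr (q - 1) - 1))"
          unfolding s_def using t \<open>1 < q\<close> by (intro mult_left_mono suminf_dyadic_powr_le) auto
        also have "\<dots> = ennreal (2 powr q * C * (4 powr (q - 1) / (2 powr (q - 1) - 1)) * \<bar>f y\<bar> powr q)"
        proof -
          have "\<bar>f y\<bar> * \<bar>f y\<bar> powr (q - 1) = \<bar>f y\<bar> powr q"
            using \<open>1 < q\<close> by (cases "f y = 0") (auto simp: powr_diff)
          then have eq: "2 powr q * C * \<bar>f y\<bar> * ((2 * (2 * \<bar>f y\<bar>)) powr (q - 1) / (2 powr (q - 1) - 1)) =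
              2 powr q * C * (4 powr (q - 1) / (2 powr (q - 1) - 1)) * \<bar>f y\<bar> powr q"
            by (simp add: powr_mult mult_ac)
          show ?thesis
            unfolding eq[symmetric] using C(1) by (intro ennreal_mult'[symmetric]) auto
        qed
        also have "\<dots> \<le> ennreal (A * \<bar>f y\<bar> powr q)"
          using A_ge by (intro ennreal_leI mult_right_mono) auto
        also have "\<dots> = ennreal A * ennreal (\<bar>f y\<bar> powr q)"
          by (simp add: ennreal_mult'')
        finally show ?thesis .
      qed
      have "upper_nn_integral M (\<lambda>y. epowr (?F y) q) \<le> (\<integral>\<^sup>+y. ennreal (t powr q) + (\<Sum>k. ?G k y) \<partial>M)"
      proof (rule upper_nn_integral_le)
        show "epowr (?F y) q \<le> ennreal (t powr q) + (\<Sum>k. ?G k y)" for y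
          using t \<open>1 < q\<close> sub unfolding s_def by (intro epowr_le_dyadic_sum) auto
      qed measurable
      also have "\<dots> = ennreal (t powr q * measure M (space M)) + (\<Sum>k. \<integral>\<^sup>+y. ?G k y \<partial>M)"
        by (simp add: nn_integral_add nn_integral_suminf emeasure_eq_measure ennreal_mult'')
      also have "\<dots> \<le> ennreal (t powr q * measure M (space M)) + (\<Sum>k. \<integral>\<^sup>+y. ?H k y \<partial>M)"
        by (intro add_left_mono suminf_le GH) auto
      also have "(\<Sum>k. \<integral>\<^sup>+y. ?H k y \<partial>M) = (\<integral>\<^sup>+y. (\<Sum>k. ?H k y) \<partial>M)"
        by (simp add: nn_integral_suminf)
      also have "\<dots> \<le> (\<integral>\<^sup>+y. ennreal A * ennreal (\<bar>f y\<bar> powr q) \<partial>M)"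
        by (intro nn_integral_mono H)
      also have "\<dots> = ennreal A * ?I"
        by (simp add: nn_integral_cmult)
      finally show ?thesis
        by (simp add: add.commute add_mono)
    qed
    show "upper_nn_integral M (\<lambda>y. epowr (?F y) q) \<le> ennreal A * ?I"
    proof (rule ennreal_le_epsilon)
      fix e :: real assume "0 < e"
      define m where "m = measure M (space M)"
      \<comment> \<open>Chosen so that the error is \<open>e * m / (m + 1)\<close>, which is at most
        \<open>e\<close>.\<close>
      define t where "t = (e / (m + 1)) powr (1 / q)"
      have m: "0 \<le> m"
        by (simp add: m_def)
      then have t: "0 < t"
        using \<open>0 < e\<close> by (simp add: t_def)
      have "t powr q * m \<le> e"
        using \<open>0 < e\<close> \<open>1 < q\<close> m by (simp add: t_def powr_powr field_simps)
      then show "upper_nn_integral M (\<lambda>y. epowr (?F y) q) \<le> ennreal A * ?I + ennreal e"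
        unfolding m_def by (intro order_trans[OF level[OF t]] add_left_mono ennreal_leI)
    qed
  qed
qed

subsection \<open>Morrey spaces\<close>

text \<open>Points are null and balls are not, so a ball contains a point other than its
  centre.\<close>

lemma qdiam_pos: "0 < qdiam \<rho>"
proof -
  obtain x :: 'a where True by simp
  have "qball \<rho> x 1 \<noteq> {x}"
    using qball_pos[of 1 x] singleton_null[of x] by (metis less_irrefl null_setsD1 zero_less_one)
  then obtain y where "y \<noteq> x"
    using centre_in_qball[of 1 x] by auto
  then have "0 < \<rho> x y"
    using rho_nonneg[of x y] rho_eq_0_iff[of x y] by auto
  then show ?thesis
    using rho_le_qdiam[of x y] by simp
qed

text \<open>The hypothesis speaks only of radii below the diameter, and such balls need not be the
  whole space. Balls of half the diameter cover it; they are dilates of disjoint balls, each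
  carrying at least the fraction \<open>1 / C\<close> of the total measure.\<close>

lemma nn_integral_le_of_qballs:
  obtains C where "1 \<le> C"
    "\<And>F T lam. F \<in> borel_measurable M \<Longrightarrow> 0 \<le> T \<Longrightarrow> 0 \<le> lam \<Longrightarrow>
      (\<And>z s. 0 < s \<Longrightarrow> s < qdiam \<rho> \<Longrightarrow>
        (\<integral>\<^sup>+y\<in>qball \<rho> z s. F y \<partial>M) \<le> ennreal (T * measure M (qball \<rho> z s) powr lam)) \<Longrightarrow>
      (\<integral>\<^sup>+y. F y \<partial>M) \<le> ennreal (C * T * measure M UNIV powr lam)"
proof -
  obtain K where K: "1 \<le> K" and cover: "\<And>A r. (\<And>y. y \<in> A \<Longrightarrow> 0 < r y) \<Longrightarrow> bdd_above (r ` A) \<Longrightarrow>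
      \<exists>S\<subseteq>A. countable S \<and> disjoint_family_on (\<lambda>z. qball \<rho> z (r z)) S \<and>
        A \<subseteq> (\<Union>z\<in>S. qball \<rho> z (K * r z))"
    by (rule Vitali_covering_qball) blast
  \<comment> \<open>\<open>K * s\<close> is half the diameter, so the hypothesis applies to the
    covering balls; \<open>4 * K * s\<close> is twice the diameter, so this dilate is the whole
    space and doubling compares \<open>m\<close> with the small balls.\<close>
  define s where "s = qdiam \<rho> / (2 * K)"
  have s: "0 < s" "0 < K * s" "K * s < qdiam \<rho>" "qdiam \<rho> < 4 * K * s"
    using K qdiam_pos by (auto simp: s_def)
  obtain D where D: "1 \<le> D"
    "\<And>x r. 0 < r \<Longrightarrow> measure M (qball \<rho> x (4 * K * r)) \<le> D * measure M (qball \<rho> x r)"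
    by (rule doubling_scaled) blast
  obtain S where S: "countable S" "disjoint_family_on (\<lambda>z. qball \<rho> z s) S"
      "UNIV \<subseteq> (\<Union>z\<in>S. qball \<rho> z (K * s))"
    using cover[of UNIV "\<lambda>_. s"] s(1) by auto
  have meas[measurable]: "qball \<rho> z s \<in> sets M" "qball \<rho> z (K * s) \<in> sets M" for z
    using s by (auto intro: qball_measurable)
  define m where "m = measure M UNIV"
  have m: "0 < m"
    using measure_qball_pos[OF s(1)] bounded_measure less_le_trans
    unfolding m_def space_UNIV by metis
  have m_le: "m \<le> D * measure M (qball \<rho> z s)" for z
    using D(2)[OF s(1), of z] qball_eq_UNIV[OF s(4)] by (simp add: m_def)
  show thesis
  proof (rule that[OF D(1)])
    fix F :: "'a \<Rightarrow> ennreal" and T lam :: real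
    assume [measurable]: "F \<in> borel_measurable M" and T: "0 \<le> T" and "0 \<le> lam"
      and le: "\<And>z s. 0 < s \<Longrightarrow> s < qdiam \<rho> \<Longrightarrow>
        (\<integral>\<^sup>+y\<in>qball \<rho> z s. F y \<partial>M) \<le> ennreal (T * measure M (qball \<rho> z s) powr lam)"
    have "(\<integral>\<^sup>+y. F y \<partial>M) = (\<integral>\<^sup>+y\<in>UNIV. F y \<partial>M)"
      by simp
    also have "\<dots> \<le> (\<integral>\<^sup>+z. (\<integral>\<^sup>+y\<in>qball \<rho> z (K * s). F y \<partial>M) \<partial>count_space S)"
      using S by (intro nn_integral_cover_le) auto
    \<comment> \<open>Instead of counting the balls, the bound for each is written as the integral
      of a constant over its small ball; these are disjoint, so the sum is at most the integral over
      the space.\<close>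
    also have "\<dots> \<le> (\<integral>\<^sup>+z. (\<integral>\<^sup>+y\<in>qball \<rho> z s. ennreal (D * T * m powr lam / m) \<partial>M) \<partial>count_space S)"
    proof (rule nn_integral_mono)
      fix z
      have "(\<integral>\<^sup>+y\<in>qball \<rho> z (K * s). F y \<partial>M) \<le> ennreal (T * measure M (qball \<rho> z (K * s)) powr lam)"
        using s by (intro le)
      also have "\<dots> \<le> ennreal (T * m powr lam)"
        using T \<open>0 \<le> lam\<close> bounded_measure[of "qball \<rho> z (K * s)"]
        by (intro ennreal_leI mult_left_mono powr_mono2) (auto simp: m_def space_UNIV)
      also have "\<dots> \<le> ennreal (D * T * m powr lam / m * measure M (qball \<rho> z s))"
      proof (rule ennreal_leI)
        have "T * m powr lam / m * m \<le> T * m powr lam / m * (D * measure M (qball \<rho> z s))"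
          using T m by (intro mult_left_mono m_le) auto
        then show "T * m powr lam \<le> D * T * m powr lam / m * measure M (qball \<rho> z s)"
          using m by (simp add: mult_ac)
      qed
      also have "\<dots> = (\<integral>\<^sup>+y\<in>qball \<rho> z s. ennreal (D * T * m powr lam / m) \<partial>M)"
        by (subst nn_integral_cmult_indicator) (auto simp only: meas emeasure_eq_measure ennreal_mult'' measure_nonneg)
      finally show "(\<integral>\<^sup>+y\<in>qball \<rho> z (K * s). F y \<partial>M) \<le> (\<integral>\<^sup>+y\<in>qball \<rho> z s. ennreal (D * T * m powr lam / m) \<partial>M)" .
    qed
    also have "\<dots> \<le> (\<integral>\<^sup>+y. ennreal (D * T * m powr lam / m) \<partial>M)"
      using S by (intro nn_integral_disjoint_le) auto
    also have "\<dots> = ennreal (D * T * m powr lam / m * m)"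
      by (simp only: nn_integral_const emeasure_eq_measure m_def space_UNIV ennreal_mult'' measure_nonneg)
    also have "D * T * m powr lam / m * m = D * T * m powr lam"
      using m by simp
    finally show "(\<integral>\<^sup>+y. F y \<partial>M) \<le> ennreal (D * T * measure M UNIV powr lam)"
      by (simp add: m_def)
  qed
qed

text \<open>The dilated ball may have a radius not below the diameter, where the hypothesis says nothing.\<close>

lemma nn_integral_dilated_qball_le:
  assumes "0 < K"
  obtains C where "1 \<le> C"
    "\<And>F T lam x r. F \<in> borel_measurable M \<Longrightarrow> 0 \<le> T \<Longrightarrow> 0 \<le> lam \<Longrightarrow> lam \<le> 1 \<Longrightarrow> 0 < r \<Longrightarrow>
      (\<And>z s. 0 < s \<Longrightarrow> s < qdiam \<rho> \<Longrightarrow>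
        (\<integral>\<^sup>+y\<in>qball \<rho> z s. F y \<partial>M) \<le> ennreal (T * measure M (qball \<rho> z s) powr lam)) \<Longrightarrow>
      (\<integral>\<^sup>+y\<in>qball \<rho> x (K * r). F y \<partial>M) \<le> ennreal (C * T * measure M (qball \<rho> x r) powr lam)"
proof -
  obtain D where D: "1 \<le> D"
    "\<And>x r. 0 < r \<Longrightarrow> measure M (qball \<rho> x (2 * K * r)) \<le> D * measure M (qball \<rho> x r)"
    by (rule doubling_scaled) blast
  obtain C where C: "1 \<le> C"
    "\<And>F T lam. F \<in> borel_measurable M \<Longrightarrow> 0 \<le> T \<Longrightarrow> 0 \<le> lam \<Longrightarrow>
      (\<And>z s. 0 < s \<Longrightarrow> s < qdiam \<rho> \<Longrightarrow>
        (\<integral>\<^sup>+y\<in>qball \<rho> z s. F y \<partial>M) \<le> ennreal (T * measure M (qball \<rho> z s) powr lam)) \<Longrightarrow>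
      (\<integral>\<^sup>+y. F y \<partial>M) \<le> ennreal (C * T * measure M UNIV powr lam)"
    by (rule nn_integral_le_of_qballs) blast
  show thesis
  proof (rule that[of "C * D"])
    show "1 \<le> C * D"
      using C(1) D(1) mult_mono[of 1 C 1 D] by simp
  next
    fix F :: "'a \<Rightarrow> ennreal" and T lam r :: real and x
    assume [measurable]: "F \<in> borel_measurable M" and T: "0 \<le> T" and lam: "0 \<le> lam" "lam \<le> 1"
      and r: "0 < r" and le: "\<And>z s. 0 < s \<Longrightarrow> s < qdiam \<rho> \<Longrightarrow>
        (\<integral>\<^sup>+y\<in>qball \<rho> z s. F y \<partial>M) \<le> ennreal (T * measure M (qball \<rho> z s) powr lam)"
    \<comment> \<open>The factor 2 matters: balls are defined by a strict inequality, so a ball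
      whose radius equals the diameter may miss points, whereas the radius \<open>2 * K * r\<close>
      then exceeds the diameter.\<close>
    define B where "B = qball \<rho> x (2 * K * r)"
    define m where "m = measure M (qball \<rho> x r)"
    have "0 < K * r"
      using r \<open>0 < K\<close> by simp
    have "(\<integral>\<^sup>+y\<in>qball \<rho> x (K * r). F y \<partial>M) \<le> ennreal (C * T * measure M B powr lam)"
    proof (cases "K * r < qdiam \<rho>")
      case True
      have "measure M (qball \<rho> x (K * r)) \<le> measure M B"
        unfolding B_def using \<open>0 < K * r\<close> by (intro measure_qball_mono qball_mono) auto
      then have "1 * T * measure M (qball \<rho> x (K * r)) powr lam \<le> C * T * measure M B powr lam"
        using T C(1) lam by (intro mult_mono powr_mono2) auto
      with le[OF \<open>0 < K * r\<close> True, of x] show ?thesis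
        by (auto intro: order_trans ennreal_leI)
    next
      case False
      then have "B = UNIV"
        unfolding B_def using qdiam_pos by (intro qball_eq_UNIV) auto
      have "(\<integral>\<^sup>+y\<in>qball \<rho> x (K * r). F y \<partial>M) \<le> (\<integral>\<^sup>+y. F y \<partial>M)"
        by (intro nn_integral_mono) (auto simp: indicator_def)
      also have "\<dots> \<le> ennreal (C * T * measure M B powr lam)"
        unfolding \<open>B = UNIV\<close> using T lam le by (intro C(2)) auto
      finally show ?thesis .
    qed
    also have "\<dots> \<le> ennreal (C * D * T * m powr lam)"
    proof (rule ennreal_leI)
      have "measure M B powr lam \<le> (D * m) powr lam"
        using D(2)[OF r, of x] lam by (intro powr_mono2) (auto simp: B_def m_def)
      also have "\<dots> \<le> D * m powr lam"
        using D(1) lam powr_mono[of lam 1 D] by (auto simp: powr_mult m_def intro!: mult_right_mono)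
      finally have "C * T * measure M B powr lam \<le> C * T * (D * m powr lam)"
        using C(1) T by (intro mult_left_mono) auto
      then show "C * T * measure M B powr lam \<le> C * D * T * m powr lam"
        by (simp add: mult_ac)
    qed
    finally show "(\<integral>\<^sup>+y\<in>qball \<rho> x (K * r). F y \<partial>M) \<le> ennreal (C * D * T * measure M (qball \<rho> x r) powr lam)"
      by (simp add: m_def)
  qed
qed

text \<open>\<open>T\<close> stands for the \<open>q\<close>-th power of the Morrey norm. In the
  constant, \<open>A * L\<close> comes from balls of radius below \<open>r\<close>, which see only
  the dilate, and \<open>2 powr p * D\<close> from larger balls.\<close>

lemma hl_maximal_Morrey:
  assumes "1 < q0" "0 \<le> lam" "lam < 1"
  obtains C where "1 \<le> C"
    "\<And>f q T x r. f \<in> borel_measurable M \<Longrightarrow> q0 \<le> q \<Longrightarrow> q \<le> p \<Longrightarrow> 0 < T \<Longrightarrow> 0 < r \<Longrightarrow>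
      (\<And>z s. 0 < s \<Longrightarrow> s < qdiam \<rho> \<Longrightarrow>
        (\<integral>\<^sup>+y\<in>qball \<rho> z s. ennreal (\<bar>f y\<bar> powr q) \<partial>M) \<le> ennreal (T * measure M (qball \<rho> z s) powr lam)) \<Longrightarrow>
      upper_nn_integral M (\<lambda>y. epowr (hl_maximal M \<rho> f y) q * indicator (qball \<rho> x r) y)
        \<le> ennreal (C * T * measure M (qball \<rho> x r) powr lam)"
proof -
  obtain K where K: "1 \<le> K"
    "\<And>x y r s. y \<in> qball \<rho> x r \<Longrightarrow> s \<le> r \<Longrightarrow> qball \<rho> y s \<subseteq> qball \<rho> x (K * r)"
    "\<And>x y r s. y \<in> qball \<rho> x r \<Longrightarrow> r \<le> s \<Longrightarrow> qball \<rho> x r \<subseteq> qball \<rho> y (K * s)"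
    by (rule qball_engulfing) blast
  obtain D where D: "1 \<le> D"
    "\<And>x r. 0 < r \<Longrightarrow> measure M (qball \<rho> x (K * r)) \<le> D * measure M (qball \<rho> x r)"
    by (rule doubling_scaled) blast
  obtain A where A: "1 \<le> A"
    "\<And>f q. f \<in> borel_measurable M \<Longrightarrow> q0 \<le> q \<Longrightarrow> q \<le> p \<Longrightarrow>
       upper_nn_integral M (\<lambda>y. epowr (hl_maximal M \<rho> f y) q) \<le>
       ennreal A * (\<integral>\<^sup>+y. ennreal (\<bar>f y\<bar> powr q) \<partial>M)"
    using \<open>1 < q0\<close> by (rule hl_maximal_strong_type) blast
  have "0 < K"
    using K(1) by simp
  then obtain L where L: "1 \<le> L"
    "\<And>F T lam x r. F \<in> borel_measurable M \<Longrightarrow> 0 \<le> T \<Longrightarrow> 0 \<le> lam \<Longrightarrow> lam \<le> 1 \<Longrightarrow> 0 < r \<Longrightarrow>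
      (\<And>z s. 0 < s \<Longrightarrow> s < qdiam \<rho> \<Longrightarrow>
        (\<integral>\<^sup>+y\<in>qball \<rho> z s. F y \<partial>M) \<le> ennreal (T * measure M (qball \<rho> z s) powr lam)) \<Longrightarrow>
      (\<integral>\<^sup>+y\<in>qball \<rho> x (K * r). F y \<partial>M) \<le> ennreal (L * T * measure M (qball \<rho> x r) powr lam)"
    by (rule nn_integral_dilated_qball_le) blast
  show thesis
  proof (rule that[of "2 powr p * D + A * L"])
    show "1 \<le> 2 powr p * D + A * L"
      using A(1) L(1) D(1) mult_mono[of 1 A 1 L] by (simp add: add_increasing)
  next
    fix f :: "'a \<Rightarrow> real" and q T r :: real and x
    assume f[measurable]: "f \<in> borel_measurable M" and q: "q0 \<le> q" "q \<le> p" and T: "0 < T" and r: "0 < r"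
      and le: "\<And>z s. 0 < s \<Longrightarrow> s < qdiam \<rho> \<Longrightarrow>
        (\<integral>\<^sup>+y\<in>qball \<rho> z s. ennreal (\<bar>f y\<bar> powr q) \<partial>M) \<le> ennreal (T * measure M (qball \<rho> z s) powr lam)"
    have "1 < q"
      using q assms by simp
    define m where "m = measure M (qball \<rho> x r)"
    have m: "0 < m"
      unfolding m_def using r by (rule measure_qball_pos)
    have [measurable]: "qball \<rho> x r \<in> sets M" "qball \<rho> x (K * r) \<in> sets M"
      using r \<open>0 < K\<close> by (auto intro: qball_measurable)
    define g where "g y = f y * indicator (qball \<rho> x (K * r)) y" for y
    have g[measurable]: "g \<in> borel_measurable M"
      unfolding g_def by measurable
    \<comment> \<open>With this \<open>t\<close>, every ball of measure \<open>m'\<close> and radius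
      at least \<open>r\<close> centred in the given ball satisfies
      \<open>T * m' powr lam \<le> t powr q * m'\<close>: one has \<open>m \<le> D * m'\<close>, and
      the power \<open>1 - lam\<close>, at most 1, keeps the constant at most
      \<open>D\<close>.\<close>
    define t where "t = (D * T / m powr (1 - lam)) powr (1 / q)"
    have t: "0 < t" and t_q: "t powr q = D * T / m powr (1 - lam)"
      using D(1) T m \<open>1 < q\<close> by (auto simp: t_def powr_powr)
    have large: "(\<integral>\<^sup>+w\<in>qball \<rho> y s. ennreal \<bar>f w\<bar> \<partial>M) \<le> ennreal (2 * t) * emeasure M (qball \<rho> y s)"
      if y: "y \<in> qball \<rho> x r" and s: "r \<le> s" "s < qdiam \<rho>" for y s
    proof -
      define m' where "m' = measure M (qball \<rho> y s)"
      have "0 < s"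
        using r s by simp
      then have [measurable]: "qball \<rho> y s \<in> sets M" and m': "0 < m'"
        unfolding m'_def by (auto intro: qball_measurable measure_qball_pos)
      have "m \<le> measure M (qball \<rho> y (K * s))"
        unfolding m_def using K(3)[OF y s(1)] \<open>0 < K\<close> \<open>0 < s\<close> by (intro measure_qball_mono) auto
      also have "\<dots> \<le> D * m'"
        unfolding m'_def using \<open>0 < s\<close> by (rule D(2))
      finally have "m powr (1 - lam) \<le> (D * m') powr (1 - lam)"
        using m assms by (intro powr_mono2) auto
      also have "\<dots> \<le> D * m' powr (1 - lam)"
        using D(1) assms powr_mono[of "1 - lam" 1 D] by (auto simp: powr_mult intro!: mult_right_mono)
      finally have "T * m' powr lam * m powr (1 - lam) \<le> T * m' powr lam * (D * m' powr (1 - lam))"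
        using T by (intro mult_left_mono) auto
      also have "\<dots> = D * T * m'"
        using m' by (simp add: powr_diff)
      finally have "T * m' powr lam \<le> t powr q * m'"
        using m by (simp add: t_q field_simps)
      then have "(\<integral>\<^sup>+w\<in>qball \<rho> y s. ennreal (\<bar>f w\<bar> powr q) \<partial>M) \<le> ennreal (t powr q * m')"
        using le[OF \<open>0 < s\<close> s(2), of y] unfolding m'_def by (auto intro: order_trans ennreal_leI)
      also have "(\<integral>\<^sup>+w\<in>qball \<rho> y s. ennreal (\<bar>f w\<bar> powr q) \<partial>M) =
          upper_nn_integral M (\<lambda>w. epowr (ennreal \<bar>f w\<bar>) q * indicator (qball \<rho> y s) w)"
        by (subst upper_nn_integral_eq) (auto simp: epowr_ennreal)
      also have "ennreal (t powr q * m') = ennreal (t powr q) * emeasure M (qball \<rho> y s)"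
        by (simp add: emeasure_eq_measure m'_def ennreal_mult)
      finally have "upper_nn_integral M (\<lambda>w. epowr (ennreal \<bar>f w\<bar>) 1 * indicator (qball \<rho> y s) w)
          \<le> ennreal (2 * t powr 1) * emeasure M (qball \<rho> y s)"
        using t \<open>1 < q\<close> by (intro upper_nn_integral_power_mean) auto
      also have "upper_nn_integral M (\<lambda>w. epowr (ennreal \<bar>f w\<bar>) 1 * indicator (qball \<rho> y s) w) =
          (\<integral>\<^sup>+w\<in>qball \<rho> y s. ennreal \<bar>f w\<bar> \<partial>M)"
        by (subst upper_nn_integral_eq) (auto simp: epowr_ennreal)
      finally show ?thesis
        using t by simp
    qed
    \<comment> \<open>A maximum suffices because each radius falls under one of the two cases; its
      \<open>q\<close>-th power is then bounded by a sum without a convexity constant.\<close>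
    have split: "hl_maximal M \<rho> f y \<le> max (hl_maximal M \<rho> g y) (ennreal (2 * t))"
      if y: "y \<in> qball \<rho> x r" for y
      unfolding hl_maximal_le_iff
    proof
      fix s assume s: "s \<in> {0<..<qdiam \<rho>}"
      show "(\<integral>\<^sup>+w\<in>qball \<rho> y s. ennreal \<bar>f w\<bar> \<partial>M) \<le>
          max (hl_maximal M \<rho> g y) (ennreal (2 * t)) * emeasure M (qball \<rho> y s)"
      proof (cases "r \<le> s")
        case True
        then show ?thesis
          using s by (intro order_trans[OF large[OF y]] mult_right_mono) auto
      next
        case False
        then have "qball \<rho> y s \<subseteq> qball \<rho> x (K * r)"
          using y by (intro K(2)) auto
        then have "(\<integral>\<^sup>+w\<in>qball \<rho> y s. ennreal \<bar>f w\<bar> \<partial>M) = (\<integral>\<^sup>+w\<in>qball \<rho> y s. ennreal \<bar>g w\<bar> \<partial>M)"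
          by (intro nn_integral_cong) (auto simp: g_def indicator_def)
        also have "\<dots> \<le> hl_maximal M \<rho> g y * emeasure M (qball \<rho> y s)"
          using hl_maximal_le_iff[of g y "hl_maximal M \<rho> g y"] s by simp
        also have "\<dots> \<le> max (hl_maximal M \<rho> g y) (ennreal (2 * t)) * emeasure M (qball \<rho> y s)"
          by (intro mult_right_mono) auto
        finally show ?thesis .
      qed
    qed
    have "(\<integral>\<^sup>+y. ennreal (\<bar>g y\<bar> powr q) \<partial>M) = (\<integral>\<^sup>+y\<in>qball \<rho> x (K * r). ennreal (\<bar>f y\<bar> powr q) \<partial>M)"
      by (intro nn_integral_cong) (auto simp: g_def indicator_def)
    also have "\<dots> \<le> ennreal (L * T * m powr lam)"
      unfolding m_def using T assms r le by (intro L(2)) auto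
    finally have g_le: "(\<integral>\<^sup>+y. ennreal (\<bar>g y\<bar> powr q) \<partial>M) \<le> ennreal (L * T * m powr lam)" .
    have "epowr (hl_maximal M \<rho> f y) q * indicator (qball \<rho> x r) y \<le>
        ennreal ((2 * t) powr q) * indicator (qball \<rho> x r) y + 1 * epowr (hl_maximal M \<rho> g y) q" for y
    proof (cases "y \<in> qball \<rho> x r")
      case True
      have "epowr (hl_maximal M \<rho> f y) q \<le> epowr (max (hl_maximal M \<rho> g y) (ennreal (2 * t))) q"
        using \<open>1 < q\<close> by (intro epowr_mono split True) auto
      also have "\<dots> \<le> epowr (hl_maximal M \<rho> g y) q + epowr (ennreal (2 * t)) q"
        using \<open>1 < q\<close> by (intro epowr_max_le) auto
      finally show ?thesis
        using True t by (simp add: epowr_ennreal add.commute)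
    qed simp
    then have "upper_nn_integral M (\<lambda>y. epowr (hl_maximal M \<rho> f y) q * indicator (qball \<rho> x r) y) \<le>
        (\<integral>\<^sup>+y. ennreal ((2 * t) powr q) * indicator (qball \<rho> x r) y \<partial>M) +
        1 * upper_nn_integral M (\<lambda>y. epowr (hl_maximal M \<rho> g y) q)"
      by (intro upper_nn_integral_affine_le) auto
    also have "\<dots> \<le> ennreal ((2 * t) powr q * m) + ennreal A * ennreal (L * T * m powr lam)"
      unfolding mult_1
    proof (rule add_mono)
      show "upper_nn_integral M (\<lambda>y. epowr (hl_maximal M \<rho> g y) q) \<le> ennreal A * ennreal (L * T * m powr lam)"
        using A(2)[OF g q] mult_left_mono[OF g_le] by (rule order_trans) simp
    qed (simp add: nn_integral_cmult_indicator emeasure_eq_measure m_def ennreal_mult'')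
    also have "\<dots> = ennreal ((2 * t) powr q * m + A * L * T * m powr lam)"
      using A(1) L(1) T m by (simp add: mult.assoc flip: ennreal_mult ennreal_plus)
    also have "\<dots> \<le> ennreal ((2 powr p * D + A * L) * T * m powr lam)"
    proof (rule ennreal_leI)
      have "(2 * t) powr q * m = 2 powr q * (D * T * m powr lam)"
        using t m by (simp add: powr_mult t_q powr_diff)
      also have "\<dots> \<le> 2 powr p * (D * T * m powr lam)"
        using D(1) T q by (intro mult_right_mono powr_mono) auto
      finally show "(2 * t) powr q * m + A * L * T * m powr lam \<le> (2 powr p * D + A * L) * T * m powr lam"
        by (simp add: algebra_simps)
    qed
    finally show "upper_nn_integral M (\<lambda>y. epowr (hl_maximal M \<rho> f y) q * indicator (qball \<rho> x r) y)
        \<le> ennreal ((2 powr p * D + A * L) * T * measure M (qball \<rho> x r) powr lam)"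
      by (simp add: m_def)
  qed
qed

section \<open>The grand norm: estimates uniform in \<open>\<epsilon>\<close>\<close>

text \<open>Clearing the root and the weights turns a norm bound into Morrey estimates, one for each
  \<open>\<epsilon>\<close>, with exponent \<open>p - \<epsilon>\<close> and
  \<open>T = N powr (p - \<epsilon>) / \<epsilon> powr \<theta>\<close>.\<close>

lemma grand_morrey_norm_le_iff:
  assumes "0 \<le> N"
  shows "grand_morrey_norm M \<rho> p \<theta> lam F \<le> ennreal N \<longleftrightarrow>
    (\<forall>\<epsilon> x r. 0 < \<epsilon> \<longrightarrow> \<epsilon> < p - 1 \<longrightarrow> 0 < r \<longrightarrow> r < qdiam \<rho> \<longrightarrow>
      upper_nn_integral M (\<lambda>y. epowr (F y) (p - \<epsilon>) * indicator (qball \<rho> x r) y)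
        \<le> ennreal (N powr (p - \<epsilon>) / \<epsilon> powr \<theta> * measure M (qball \<rho> x r) powr lam))"
proof -
  have "epowr (ennreal (\<epsilon> powr \<theta> / measure M (qball \<rho> x r) powr lam) * I) (1 / (p - \<epsilon>)) \<le> ennreal N
      \<longleftrightarrow> I \<le> ennreal (N powr (p - \<epsilon>) / \<epsilon> powr \<theta> * measure M (qball \<rho> x r) powr lam)"
    if "0 < \<epsilon>" "\<epsilon> < p - 1" "0 < r" for \<epsilon> x r I
    using that assms measure_qball_pos[of r x]
    by (subst epowr_le_iff, simp, simp, subst ennreal_mult_le_iff) (auto simp: field_simps)
  then show ?thesis
    unfolding grand_morrey_norm_def SUP_le_iff by auto
qed

text \<open>The constant of the Morrey estimate blows up as \<open>\<epsilon> \<rightarrow> p - 1\<close>. Beyond the midpoint \<open>\<sigma>\<close> the estimate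
  is derived from the one at \<open>\<sigma>\<close> by comparing power means.\<close>

lemma hl_maximal_grand_Morrey:
  assumes "1 < p" "0 < \<theta>" "0 \<le> lam" "lam < 1"
  obtains C where "1 \<le> C"
    "\<And>f N. f \<in> borel_measurable M \<Longrightarrow> 0 < N \<Longrightarrow>
      grand_morrey_norm M \<rho> p \<theta> lam (\<lambda>x. ennreal \<bar>f x\<bar>) \<le> ennreal N \<Longrightarrow>
      grand_morrey_norm M \<rho> p \<theta> lam (hl_maximal M \<rho> f) \<le> ennreal (C * N)"
proof -
  \<comment> \<open>The midpoint gives \<open>q0 = (p + 1) / 2\<close>, strictly between 1 and
    \<open>p\<close>, the smallest exponent at which the Morrey estimate is used.\<close>
  define \<sigma> where "\<sigma> = (p - 1) / 2"
  define q0 where "q0 = p - \<sigma>"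
  have \<sigma>: "0 < \<sigma>" "\<sigma> < p - 1" and q0: "1 < q0" "q0 < p"
    using assms(1) by (auto simp: \<sigma>_def q0_def field_simps)
  obtain C where C: "1 \<le> C"
    "\<And>f q T x r. f \<in> borel_measurable M \<Longrightarrow> q0 \<le> q \<Longrightarrow> q \<le> p \<Longrightarrow> 0 < T \<Longrightarrow> 0 < r \<Longrightarrow>
      (\<And>z s. 0 < s \<Longrightarrow> s < qdiam \<rho> \<Longrightarrow>
        (\<integral>\<^sup>+y\<in>qball \<rho> z s. ennreal (\<bar>f y\<bar> powr q) \<partial>M) \<le> ennreal (T * measure M (qball \<rho> z s) powr lam)) \<Longrightarrow>
      upper_nn_integral M (\<lambda>y. epowr (hl_maximal M \<rho> f y) q * indicator (qball \<rho> x r) y)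
        \<le> ennreal (C * T * measure M (qball \<rho> x r) powr lam)"
    using q0(1) assms(3,4) by (rule hl_maximal_Morrey) blast
  define G where "G = max 1 (C / \<sigma> powr \<theta>)"
  define V where "V = max 1 (measure M (space M))"
  \<comment> \<open>A product of two quantities at least 1, so that \<open>D\<close> dominates both
    \<open>C\<close>, used for \<open>\<epsilon> \<le> \<sigma>\<close>, and
    \<open>2 * p powr \<theta> * G * V\<close>, used beyond \<open>\<sigma>\<close>.\<close>
  define D where "D = C * (2 * p powr \<theta> * G * V)"
  have one_le: "1 \<le> 2 * p powr \<theta> * G * V"
  proof -
    have "1 \<le> p powr \<theta>"
      using assms by (intro ge_one_powr_ge_zero) auto
    then have "1 * 1 * 1 * 1 \<le> 2 * p powr \<theta> * G * V"
      by (intro mult_mono) (auto simp: G_def V_def)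
    then show ?thesis
      by simp
  qed
  have "1 * C \<le> D"
    unfolding D_def using one_le C(1) by (subst mult.commute) (intro mult_left_mono, auto)
  then have D: "C \<le> D" "1 \<le> D"
    using C(1) by auto
  have D': "2 * p powr \<theta> * G * V \<le> D"
    unfolding D_def using one_le C(1) mult_right_mono[of 1 C] by force
  show thesis
  proof (rule that[OF D(2)])
    fix f :: "'a \<Rightarrow> real" and N
    assume f[measurable]: "f \<in> borel_measurable M" and N: "0 < N"
      and norm_le: "grand_morrey_norm M \<rho> p \<theta> lam (\<lambda>x. ennreal \<bar>f x\<bar>) \<le> ennreal N"
    have Morrey: "upper_nn_integral M (\<lambda>y. epowr (hl_maximal M \<rho> f y) (p - \<epsilon>) * indicator (qball \<rho> x r) y)
        \<le> ennreal (C * (N powr (p - \<epsilon>) / \<epsilon> powr \<theta>) * measure M (qball \<rho> x r) powr lam)"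
      if \<epsilon>: "0 < \<epsilon>" "\<epsilon> \<le> \<sigma>" and r: "0 < r" for \<epsilon> x r
    proof (rule C(2)[OF f])
      fix z s assume s: "0 < s" "s < qdiam \<rho>"
      have [measurable]: "qball \<rho> z s \<in> sets M"
        using s(1) by (rule qball_measurable)
      have "(\<integral>\<^sup>+y\<in>qball \<rho> z s. ennreal (\<bar>f y\<bar> powr (p - \<epsilon>)) \<partial>M) =
          upper_nn_integral M (\<lambda>y. epowr (ennreal \<bar>f y\<bar>) (p - \<epsilon>) * indicator (qball \<rho> z s) y)"
        by (subst upper_nn_integral_eq) (auto simp: epowr_ennreal)
      also have "\<dots> \<le> ennreal (N powr (p - \<epsilon>) / \<epsilon> powr \<theta> * measure M (qball \<rho> z s) powr lam)"
        using norm_le N \<epsilon> \<sigma> s by (subst (asm) grand_morrey_norm_le_iff) auto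
      finally show "(\<integral>\<^sup>+y\<in>qball \<rho> z s. ennreal (\<bar>f y\<bar> powr (p - \<epsilon>)) \<partial>M)
          \<le> ennreal (N powr (p - \<epsilon>) / \<epsilon> powr \<theta> * measure M (qball \<rho> z s) powr lam)" .
    qed (use \<epsilon> N r q0_def in auto)
    have "upper_nn_integral M (\<lambda>y. epowr (hl_maximal M \<rho> f y) (p - \<epsilon>) * indicator (qball \<rho> x r) y)
        \<le> ennreal ((D * N) powr (p - \<epsilon>) / \<epsilon> powr \<theta> * measure M (qball \<rho> x r) powr lam)"
      if \<epsilon>: "0 < \<epsilon>" "\<epsilon> < p - 1" and r: "0 < r" "r < qdiam \<rho>" for \<epsilon> x r
    proof -
      define q where "q = p - \<epsilon>"
      define m where "m = measure M (qball \<rho> x r)"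
      have m: "0 < m" "m \<le> V"
        using measure_qball_pos[OF r(1), of x] bounded_measure[of "qball \<rho> x r"] by (auto simp: m_def V_def)
      have "1 < q"
        using \<epsilon> by (simp add: q_def)
      \<comment> \<open>The estimates produce a constant outside the \<open>q\<close>-th power; this
        lets it be absorbed into \<open>(D * N) powr q\<close>.\<close>
      have D_le: "D \<le> D powr q"
        using D(2) \<open>1 < q\<close> powr_mono[of 1 q D] by simp
      show ?thesis
      proof (cases "\<epsilon> \<le> \<sigma>")
        case True
        have "C * (N powr q / \<epsilon> powr \<theta>) * m powr lam \<le> D powr q * (N powr q / \<epsilon> powr \<theta>) * m powr lam"
          using D(1) D_le by (intro mult_right_mono) auto
        also have "\<dots> = (D * N) powr q / \<epsilon> powr \<theta> * m powr lam"
          using D(2) N by (simp add: powr_mult)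
        finally show ?thesis
          using Morrey[OF \<epsilon>(1) True r(1), of x] unfolding q_def m_def by (auto intro: order_trans ennreal_leI)
      next
        case False
        then have q: "q < q0"
          by (simp add: q_def q0_def)
        define \<alpha> where "\<alpha> = q / q0"
        have \<alpha>: "0 < \<alpha>" "\<alpha> < 1"
          using q \<open>1 < q\<close> by (auto simp: \<alpha>_def)
        \<comment> \<open>Chosen so that \<open>t powr q0 * m\<close> is the right-hand side of the
          Morrey estimate at \<open>\<sigma>\<close>, that is, \<open>t powr q0\<close> bounds the
          mean of the \<open>q0\<close>-th powers over the ball.\<close>
        define Z where "Z = C / \<sigma> powr \<theta> * m powr (lam - 1)"
        define t where "t = Z powr (1 / q0) * N"
        have Z: "0 < Z"
          using C(1) \<sigma> m by (simp add: Z_def)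
        then have t: "0 < t"
          using N by (simp add: t_def)
        have "t powr q0 = Z * N powr q0"
          unfolding t_def using Z N q0 by (subst powr_mult) (auto simp: powr_powr)
        then have "C * (N powr q0 / \<sigma> powr \<theta>) * m powr lam = t powr q0 * m"
          using m by (simp add: Z_def powr_diff)
        then have "upper_nn_integral M (\<lambda>y. epowr (hl_maximal M \<rho> f y) q0 * indicator (qball \<rho> x r) y)
            \<le> ennreal (t powr q0) * emeasure M (qball \<rho> x r)"
          using Morrey[OF \<sigma>(1) order_refl r(1), of x]
          by (simp add: q0_def m_def emeasure_eq_measure ennreal_mult)
        then have "upper_nn_integral M (\<lambda>y. epowr (hl_maximal M \<rho> f y) q * indicator (qball \<rho> x r) y)
            \<le> ennreal (2 * t powr q) * emeasure M (qball \<rho> x r)"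
          using t q \<open>1 < q\<close> r by (intro upper_nn_integral_power_mean qball_measurable) auto
        also have "\<dots> = ennreal (2 * t powr q * m)"
          by (simp add: emeasure_eq_measure m_def ennreal_mult)
        also have "\<dots> \<le> ennreal ((D * N) powr q / \<epsilon> powr \<theta> * m powr lam)"
        proof (rule ennreal_leI)
          have "t powr q = Z powr \<alpha> * N powr q"
            unfolding t_def \<alpha>_def using Z N by (subst powr_mult) (auto simp: powr_powr)
          also have "\<dots> = (C / \<sigma> powr \<theta>) powr \<alpha> * m powr ((lam - 1) * \<alpha>) * N powr q"
            unfolding Z_def using C(1) by (subst powr_mult) (auto simp: powr_powr)
          finally have t_q: "t powr q = (C / \<sigma> powr \<theta>) powr \<alpha> * m powr ((lam - 1) * \<alpha>) * N powr q" .
          \<comment> \<open>The norm requires the factor \<open>m powr lam\<close>; the surplus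
            exponent \<open>(1 - lam) * (1 - \<alpha>)\<close> lies between 0 and 1, so the surplus
            power of \<open>m\<close> is at most \<open>V\<close>.\<close>
          have "(lam - 1) * \<alpha> + 1 = (1 - lam) * (1 - \<alpha>) + lam"
            by (simp add: algebra_simps)
          then have "m powr ((lam - 1) * \<alpha>) * m powr 1 = m powr ((1 - lam) * (1 - \<alpha>)) * m powr lam"
            by (simp only: powr_add[symmetric])
          then have m_split: "m powr ((lam - 1) * \<alpha>) * m = m powr ((1 - lam) * (1 - \<alpha>)) * m powr lam"
            using m(1) by (simp only: powr_one less_imp_le)
          have "(C / \<sigma> powr \<theta>) powr \<alpha> \<le> G powr \<alpha>"
            using C(1) \<alpha> by (intro powr_mono2) (auto simp: G_def)
          also have "\<dots> \<le> G"
            using \<alpha> powr_mono[of \<alpha> 1 G] by (simp add: G_def)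
          finally have G: "(C / \<sigma> powr \<theta>) powr \<alpha> \<le> G" .
          have "(1 - lam) * (1 - \<alpha>) \<le> 1"
            using \<alpha> assms by (intro mult_le_one) auto
          have "m powr ((1 - lam) * (1 - \<alpha>)) \<le> V powr ((1 - lam) * (1 - \<alpha>))"
            using m \<alpha> assms by (intro powr_mono2) auto
          also have "\<dots> \<le> V"
            using \<open>(1 - lam) * (1 - \<alpha>) \<le> 1\<close> powr_mono[of "(1 - lam) * (1 - \<alpha>)" 1 V] by (simp add: V_def)
          finally have V: "m powr ((1 - lam) * (1 - \<alpha>)) \<le> V" .
          have "\<epsilon> powr \<theta> \<le> p powr \<theta>"
            using \<epsilon> assms by (intro powr_mono2) auto
          then have "2 * \<epsilon> powr \<theta> * (C / \<sigma> powr \<theta>) powr \<alpha> * m powr ((1 - lam) * (1 - \<alpha>)) \<le> 2 * p powr \<theta> * G * V"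
            using G V by (intro mult_mono) (auto simp: G_def)
          also have "\<dots> \<le> D powr q"
            using D' D_le by simp
          finally have "2 * \<epsilon> powr \<theta> * (C / \<sigma> powr \<theta>) powr \<alpha> * m powr ((1 - lam) * (1 - \<alpha>)) \<le> D powr q" .
          then have "2 * \<epsilon> powr \<theta> * (C / \<sigma> powr \<theta>) powr \<alpha> * m powr ((1 - lam) * (1 - \<alpha>)) * (N powr q / \<epsilon> powr \<theta> * m powr lam)
              \<le> D powr q * (N powr q / \<epsilon> powr \<theta> * m powr lam)"
            by (rule mult_right_mono) simp
          also have "\<dots> = (D * N) powr q / \<epsilon> powr \<theta> * m powr lam"
            using D(2) N by (simp add: powr_mult)
          also have "2 * \<epsilon> powr \<theta> * (C / \<sigma> powr \<theta>) powr \<alpha> * m powr ((1 - lam) * (1 - \<alpha>)) * (N powr q / \<epsilon> powr \<theta> * m powr lam) =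
              2 * (C / \<sigma> powr \<theta>) powr \<alpha> * N powr q * (m powr ((1 - lam) * (1 - \<alpha>)) * m powr lam)"
            using \<epsilon> by simp
          also have "\<dots> = 2 * t powr q * m"
            unfolding m_split[symmetric] t_q by (simp only: mult_ac)
          finally show "2 * t powr q * m \<le> (D * N) powr q / \<epsilon> powr \<theta> * m powr lam" .
        qed
        finally show ?thesis
          by (simp add: q_def m_def)
      qed
    qed
    then show "grand_morrey_norm M \<rho> p \<theta> lam (hl_maximal M \<rho> f) \<le> ennreal (D * N)"
      using D N by (subst grand_morrey_norm_le_iff) auto
  qed
qed

end

theorem theorem2p1:
  fixes M :: "'a::topological_space measure"
    and \<rho> :: "'a \<Rightarrow> 'a \<Rightarrow> real"
    and p \<theta> lam :: real
  assumes "homogeneous_type_space M \<rho>"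
    and "1 < p"
    and "0 < \<theta>"
    and "0 \<le> lam" and "lam < 1"
  shows "\<exists>C::real>0. \<forall>f\<in>grand_morrey_space M \<rho> p \<theta> lam.
           grand_morrey_norm M \<rho> p \<theta> lam (hl_maximal M \<rho> f)
             \<le> ennreal C * grand_morrey_norm M \<rho> p \<theta> lam (\<lambda>x. ennreal \<bar>f x\<bar>)"
proof -
  interpret homogeneous_type_space M \<rho>
    by (rule assms(1))
  obtain C where C: "1 \<le> C"
    "\<And>f N. f \<in> borel_measurable M \<Longrightarrow> 0 < N \<Longrightarrow>
      grand_morrey_norm M \<rho> p \<theta> lam (\<lambda>x. ennreal \<bar>f x\<bar>) \<le> ennreal N \<Longrightarrow>
      grand_morrey_norm M \<rho> p \<theta> lam (hl_maximal M \<rho> f) \<le> ennreal (C * N)"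
    using assms(2-5) by (rule hl_maximal_grand_Morrey) blast
  have "grand_morrey_norm M \<rho> p \<theta> lam (hl_maximal M \<rho> f) \<le>
      ennreal C * grand_morrey_norm M \<rho> p \<theta> lam (\<lambda>x. ennreal \<bar>f x\<bar>)"
    if f: "f \<in> grand_morrey_space M \<rho> p \<theta> lam" for f
  proof (rule ennreal_le_epsilon)
    fix e :: real assume "0 < e"
    obtain n where n: "grand_morrey_norm M \<rho> p \<theta> lam (\<lambda>x. ennreal \<bar>f x\<bar>) = ennreal n" "0 \<le> n"
      using f by (cases "grand_morrey_norm M \<rho> p \<theta> lam (\<lambda>x. ennreal \<bar>f x\<bar>)" rule: ennreal_cases)
        (auto simp: grand_morrey_space_def)
    have pos: "0 < e / C"
      using \<open>0 < e\<close> C(1) by simp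
    \<comment> \<open>The estimate is available for positive bounds, while the norm \<open>n\<close>
      may be 0. Adding \<open>e / C\<close> makes the bound positive and costs exactly
      \<open>e\<close>.\<close>
    have "grand_morrey_norm M \<rho> p \<theta> lam (hl_maximal M \<rho> f) \<le> ennreal (C * (n + e / C))"
    proof (rule C(2))
      show "f \<in> borel_measurable M"
        using f by (simp add: grand_morrey_space_def)
      show "grand_morrey_norm M \<rho> p \<theta> lam (\<lambda>x. ennreal \<bar>f x\<bar>) \<le> ennreal (n + e / C)"
        unfolding n(1) using pos by (intro ennreal_leI) simp
    qed (use n(2) pos in simp)
    also have "C * (n + e / C) = C * n + e"
      using C(1) by (simp add: distrib_left)
    also have "ennreal (C * n + e) = ennreal C * ennreal n + ennreal e"
      using C(1) n(2) \<open>0 < e\<close> by (simp add: ennreal_mult)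
    finally show "grand_morrey_norm M \<rho> p \<theta> lam (hl_maximal M \<rho> f) \<le>
        ennreal C * grand_morrey_norm M \<rho> p \<theta> lam (\<lambda>x. ennreal \<bar>f x\<bar>) + ennreal e"
      by (simp only: n(1))
  qed
  then show ?thesis
    using C(1) by (intro exI[of _ C]) auto
qed

end
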